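(* Let $z\in\mathcal{V}_0$ and $p\in\mathbb{N}_0$ be given. Consider the $L^2$-orthogonal projection $$\Pi^p_{\omega_z}\colon L^2(\Omega_z)\to P^p(\omega_z).$$ Then $\Pi^p_{\omega_z}|_{P^{p+1}(\Omega_z)}$ has full rank, i.e. $\ker(\Pi^p_{\omega_z}|_{P^{p+1}(\Omega_z)})=\{0\}$.
   Context: Let $d\in\{1,2\}$ and let $\Omega\subset\mathbb{R}^d$ be a bounded Lipschitz domain with polygonal boundary ($d=2$) or a bounded open interval ($d=1$). $\mathcal{T}$ is a conforming triangulation of $\Omega$ into open simplices (triangles if $d=2$, intervals if $d=1$), and $\mathcal{V}_0$ is the set of its interior vertices, assumed nonempty. For $z\in\mathcal{V}_0$, $\omega_z=\{T\in\mathcal{T}:z\in\overline T\}$ is the element patch of $z$ and $\Omega_z$ is the corresponding domain (the interior of the union of the closures of the elements of $\omega_z$). $P^{k}(\Omega_z)$ denotes the polynomials of (total) degree $\le k$ on $\Omega_z$, and $P^k(\omega_z)$ denotes the (generally discontinuous) functions on $\Omega_z$ whose restriction to each $T\in\omega_z$ is a polynomial of degree $\le k$. The $L^2$ inner product is the standard unweighted one. *)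

theory Defs
  imports "HOL-Analysis.Analysis"
begin

section \<open>Domains and triangulations\<close>

text \<open>Near every boundary point, and after a choice of an "upward" unit direction \<open>\<nu>\<close>, the
  set lies strictly above the graph of a Lipschitz function. Here \<open>y - (y \<bullet> \<nu>) *\<^sub>R \<nu>\<close> is the
  component of \<open>y\<close> in the hyperplane orthogonal to \<open>\<nu>\<close>; \<open>\<gamma>\<close> is only ever evaluated there.\<close>

definition lipschitz_domain :: "(real^'d) set \<Rightarrow> bool" where
  "lipschitz_domain \<Omega> \<longleftrightarrow>
     open \<Omega> \<and> connected \<Omega> \<and> \<Omega> \<noteq> {} \<and>
     (\<forall>x \<in> frontier \<Omega>. \<exists>\<nu> r L. \<exists>\<gamma> :: real^'d \<Rightarrow> real.
        norm \<nu> = 1 \<and> r > 0 \<and> L-lipschitz_on UNIV \<gamma> \<and>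
        \<Omega> \<inter> ball x r = {y \<in> ball x r. y \<bullet> \<nu> > \<gamma> (y - (y \<bullet> \<nu>) *\<^sub>R \<nu>)})"

definition polygonal_boundary :: "(real^'d) set \<Rightarrow> bool" where
  "polygonal_boundary \<Omega> \<longleftrightarrow>
     (\<exists>S. finite S \<and> frontier \<Omega> = (\<Union>(a, b) \<in> S. closed_segment a b))"

definition admissible_domain :: "(real^'d) set \<Rightarrow> bool" where
  "admissible_domain \<Omega> \<longleftrightarrow>
     (CARD('d) = 1 \<and> (\<exists>a b. \<Omega> = box a b) \<and> \<Omega> \<noteq> {}) \<or>
     (CARD('d) = 2 \<and> bounded \<Omega> \<and> lipschitz_domain \<Omega> \<and> polygonal_boundary \<Omega>)"

definition open_simplex :: "(real^'d) set \<Rightarrow> bool" where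
  "open_simplex T \<longleftrightarrow> (\<exists>K. int CARD('d) simplex K \<and> T = interior K)"

text \<open>Conformity, i.e. that any two closed elements meet in a common (possibly empty) face, is
  part of \<^const>\<open>triangulation\<close>.\<close>

definition conforming_triangulation :: "(real^'d) set \<Rightarrow> (real^'d) set set \<Rightarrow> bool" where
  "conforming_triangulation \<Omega> \<T> \<longleftrightarrow>
     (\<forall>T \<in> \<T>. open_simplex T) \<and>
     triangulation (closure ` \<T>) \<and>
     closure \<Omega> = (\<Union>T \<in> \<T>. closure T)"

definition interior_vertices :: "(real^'d) set \<Rightarrow> (real^'d) set set \<Rightarrow> (real^'d) set" where
  "interior_vertices \<Omega> \<T> = {z \<in> \<Omega>. \<exists>T \<in> \<T>. z extreme_point_of closure T}"

definition patch :: "(real^'d) set set \<Rightarrow> real^'d \<Rightarrow> (real^'d) set set" where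
  "patch \<T> z = {T \<in> \<T>. z \<in> closure T}"

definition patch_domain :: "(real^'d) set set \<Rightarrow> real^'d \<Rightarrow> (real^'d) set" where
  "patch_domain \<T> z = interior (\<Union>T \<in> patch \<T> z. closure T)"


section \<open>Polynomial spaces\<close>

definition multi_indices :: "nat \<Rightarrow> ('d::finite \<Rightarrow> nat) set" where
  "multi_indices k = {\<alpha>. (\<Sum>i\<in>UNIV. \<alpha> i) \<le> k}"

lemma finite_multi_indices: "finite (multi_indices k :: ('d::finite \<Rightarrow> nat) set)"
proof (rule finite_subset)
  show "multi_indices k \<subseteq> (UNIV :: 'd set) \<rightarrow>\<^sub>E {..k}"
  proof
    fix \<alpha> :: "'d \<Rightarrow> nat"
    assume "\<alpha> \<in> multi_indices k"
    then have "\<alpha> i \<le> k" for i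
      using member_le_sum[of i UNIV \<alpha>] by (simp add: multi_indices_def)
    then show "\<alpha> \<in> UNIV \<rightarrow>\<^sub>E {..k}"
      by auto
  qed
qed (simp add: finite_PiE)

definition polynomial_deg_le :: "nat \<Rightarrow> (real^'d \<Rightarrow> real) \<Rightarrow> bool" where
  "polynomial_deg_le k f \<longleftrightarrow>
     (\<exists>c. \<forall>x. f x = (\<Sum>\<alpha>\<in>multi_indices k. c \<alpha> * (\<Prod>i\<in>UNIV. (x $ i) ^ \<alpha> i)))"

text \<open>Functions on a set are represented by their extension by zero. Piecewise polynomials are
  moreover set to zero on the element boundaries, a null set where they carry no values; so every
  almost-everywhere class of piecewise polynomials has exactly one representative below.\<close>

definition polys_on :: "nat \<Rightarrow> (real^'d) set \<Rightarrow> (real^'d \<Rightarrow> real) set" where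
  "polys_on k S =
     {q. (\<exists>f. polynomial_deg_le k f \<and> (\<forall>x\<in>S. q x = f x)) \<and> (\<forall>x. x \<notin> S \<longrightarrow> q x = 0)}"

definition piecewise_polys :: "nat \<Rightarrow> (real^'d) set set \<Rightarrow> (real^'d \<Rightarrow> real) set" where
  "piecewise_polys k \<omega> =
     {g. (\<forall>T\<in>\<omega>. \<exists>f. polynomial_deg_le k f \<and> (\<forall>x\<in>T. g x = f x)) \<and>
         (\<forall>x. x \<notin> \<Union>\<omega> \<longrightarrow> g x = 0)}"


section \<open>Orthogonal projection in \<open>L\<^sup>2\<close>\<close>

definition L2_functions :: "(real^'d) set \<Rightarrow> (real^'d \<Rightarrow> real) set" where
  "L2_functions S =
     {f \<in> borel_measurable (lebesgue_on S). integrable (lebesgue_on S) (\<lambda>x. (f x)\<^sup>2)}"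

definition L2_inner :: "(real^'d) set \<Rightarrow> (real^'d \<Rightarrow> real) \<Rightarrow> (real^'d \<Rightarrow> real) \<Rightarrow> real" where
  "L2_inner S f g = (LINT x|lebesgue_on S. f x * g x)"

text \<open>\<open>V\<close> is meant to be a finite-dimensional space of square-integrable functions in which
  functions that agree almost everywhere on \<open>S\<close> are equal, so that \<open>g\<close> exists and is unique.\<close>

definition L2_projection ::
  "(real^'d) set \<Rightarrow> (real^'d \<Rightarrow> real) set \<Rightarrow> (real^'d \<Rightarrow> real) \<Rightarrow> (real^'d \<Rightarrow> real)" where
  "L2_projection S V =
     (\<lambda>f \<in> L2_functions S. THE g. g \<in> V \<and> (\<forall>v\<in>V. L2_inner S (\<lambda>x. f x - g x) v = 0))"

definition patch_projection ::
  "(real^'d) set set \<Rightarrow> real^'d \<Rightarrow> nat \<Rightarrow> (real^'d \<Rightarrow> real) \<Rightarrow> (real^'d \<Rightarrow> real)" where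
  "patch_projection \<T> z p =
     L2_projection (patch_domain \<T> z) (piecewise_polys p (patch \<T> z))"

end

theory Submission
  imports Defs
begin

text \<open>Let \<open>\<lambda>\<close> be the hat function of \<open>z\<close>: Lipschitz, affine on every element of the patch, positive
  inside and zero outside the patch. If \<open>q\<close> has degree at most \<open>p + 1\<close>, then \<open>div (\<lambda> \<nabla>q)\<close> is on every
  element a polynomial of degree at most \<open>p\<close>. Since \<open>q\<close> is one polynomial across the element
  boundaries and \<open>\<lambda>\<close> vanishes on the outer boundary, integration by parts over the patch produces no
  boundary terms, so \<open>q\<close> orthogonal to \<open>P\<^sup>p\<close> on every element gives \<open>\<integral> \<lambda> |\<nabla>q|\<^sup>2 = 0\<close>. Hence \<open>q\<close> is
  constant on each element, and being orthogonal to constants it is zero.\<close>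

section \<open>Polynomials\<close>

text \<open>The hat function has kinks across the element interfaces. Instead of integrating by
  parts element by element and cancelling interface terms, the proof treats
  \<open>hat * f * \<partial>_i f\<close> as one compactly supported Lipschitz function on the whole
  space, whose almost everywhere derivative has integral zero by translation invariance. The work
  thus moves into the global Lipschitz bound for \<open>hat\<close>. For this reason
  \<open>hat\<close> is built from a positively homogeneous gauge defined everywhere: any segment
  can be scaled into the star, where the gauge is linear on finitely many closed pieces.

  The degree count is tight: \<open>\<partial>_i (hat * \<partial>_i f)\<close> is a constant times
  a first derivative of degree \<open>p\<close>, plus an affine factor times a second derivative of
  degree \<open>p - 1\<close>; for \<open>p = 0\<close> the second derivative vanishes.

  As the projection is defined by a definite description, its kernel can be read as an orthogonality
  condition only after existence and uniqueness of the best approximation are settled.\<close>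

definition monomial :: "('d::finite \<Rightarrow> nat) \<Rightarrow> real^'d \<Rightarrow> real" where
  "monomial \<alpha> x = (\<Prod>i\<in>UNIV. (x $ i) ^ \<alpha> i)"

lemma polynomial_deg_le_iff:
  "polynomial_deg_le k f \<longleftrightarrow> (\<exists>c. f = (\<lambda>x. \<Sum>\<alpha>\<in>multi_indices k. c \<alpha> * monomial \<alpha> x))"
  by (simp add: polynomial_deg_le_def monomial_def fun_eq_iff)

lemma polynomial_deg_le_add:
  assumes "polynomial_deg_le k f" "polynomial_deg_le k g"
  shows "polynomial_deg_le k (\<lambda>x. f x + g x)"
proof -
  obtain c e where "f = (\<lambda>x. \<Sum>\<alpha>\<in>multi_indices k. c \<alpha> * monomial \<alpha> x)"
    "g = (\<lambda>x. \<Sum>\<alpha>\<in>multi_indices k. e \<alpha> * monomial \<alpha> x)"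
    using assms unfolding polynomial_deg_le_iff by blast
  then have "(\<lambda>x. f x + g x) = (\<lambda>x. \<Sum>\<alpha>\<in>multi_indices k. (c \<alpha> + e \<alpha>) * monomial \<alpha> x)"
    by (simp add: sum.distrib distrib_right)
  then show ?thesis
    unfolding polynomial_deg_le_iff by (rule exI[of _ "\<lambda>\<alpha>. c \<alpha> + e \<alpha>"])
qed

lemma polynomial_deg_le_cmul:
  assumes "polynomial_deg_le k f"
  shows "polynomial_deg_le k (\<lambda>x. a * f x)"
proof -
  obtain c where "f = (\<lambda>x. \<Sum>\<alpha>\<in>multi_indices k. c \<alpha> * monomial \<alpha> x)"
    using assms unfolding polynomial_deg_le_iff by blast
  then have "(\<lambda>x. a * f x) = (\<lambda>x. \<Sum>\<alpha>\<in>multi_indices k. (a * c \<alpha>) * monomial \<alpha> x)"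
    by (simp add: sum_distrib_left mult.assoc)
  then show ?thesis
    unfolding polynomial_deg_le_iff by (rule exI[of _ "\<lambda>\<alpha>. a * c \<alpha>"])
qed

lemma polynomial_deg_le_zero: "polynomial_deg_le k (\<lambda>x. 0)"
  unfolding polynomial_deg_le_iff by (rule exI[of _ "\<lambda>_. 0"]) simp

lemma polynomial_deg_le_diff:
  assumes "polynomial_deg_le k f" "polynomial_deg_le k g"
  shows "polynomial_deg_le k (\<lambda>x. f x - g x)"
  using polynomial_deg_le_add[OF assms(1) polynomial_deg_le_cmul[OF assms(2), of "-1"]] by simp

lemma polynomial_deg_le_sum:
  assumes "\<And>i. i \<in> I \<Longrightarrow> polynomial_deg_le k (f i)"
  shows "polynomial_deg_le k (\<lambda>x. \<Sum>i\<in>I. f i x)"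
  using assms
  by (induction I rule: infinite_finite_induct)
     (simp_all add: polynomial_deg_le_zero polynomial_deg_le_add)

lemma polynomial_deg_le_monomial:
  assumes "\<alpha> \<in> multi_indices k"
  shows "polynomial_deg_le k (monomial \<alpha>)"
  unfolding polynomial_deg_le_iff
  using assms
  by (intro exI[of _ "\<lambda>\<beta>. if \<beta> = \<alpha> then 1 else 0"] ext)
     (simp add: finite_multi_indices if_distrib[of "\<lambda>c. c * _"] cong: if_cong)

lemma polynomial_deg_le_const: "polynomial_deg_le k (\<lambda>x. a)"
proof -
  have "polynomial_deg_le k (monomial (\<lambda>_. 0))"
    by (rule polynomial_deg_le_monomial) (simp add: multi_indices_def)
  from polynomial_deg_le_cmul[OF this, of a] show ?thesis
    by (simp add: monomial_def)
qed

lemma polynomial_deg_le_mult: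
  assumes "polynomial_deg_le j f" "polynomial_deg_le k g"
  shows "polynomial_deg_le (j + k) (\<lambda>x. f x * g x)"
proof -
  obtain c e where "f = (\<lambda>x. \<Sum>\<alpha>\<in>multi_indices j. c \<alpha> * monomial \<alpha> x)"
    "g = (\<lambda>x. \<Sum>\<beta>\<in>multi_indices k. e \<beta> * monomial \<beta> x)"
    using assms unfolding polynomial_deg_le_iff by blast
  then have eq: "(\<lambda>x. f x * g x) = (\<lambda>x. \<Sum>\<alpha>\<in>multi_indices j. \<Sum>\<beta>\<in>multi_indices k.
      c \<alpha> * e \<beta> * monomial (\<lambda>i. \<alpha> i + \<beta> i) x)"
    by (simp add: sum_product monomial_def power_add prod.distrib mult_ac)
  show ?thesis
    unfolding eq
    by (intro polynomial_deg_le_sum polynomial_deg_le_cmul polynomial_deg_le_monomial)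
       (auto simp: multi_indices_def sum.distrib intro: add_mono)
qed

lemma polynomial_deg_le_linear:
  fixes g :: "real^'d \<Rightarrow> real"
  assumes "linear g"
  shows "polynomial_deg_le 1 g"
proof -
  have coord: "polynomial_deg_le 1 (\<lambda>x :: real^'d. x $ i)" for i
  proof -
    have "polynomial_deg_le 1 (monomial (\<lambda>j. if j = i then 1 else 0 :: nat))"
      by (rule polynomial_deg_le_monomial) (simp add: multi_indices_def)
    moreover have "monomial (\<lambda>j. if j = i then 1 else 0 :: nat) = (\<lambda>x :: real^'d. x $ i)"
    proof
      fix x :: "real^'d"
      have "monomial (\<lambda>j. if j = i then 1 else 0 :: nat) x = (\<Prod>j\<in>UNIV. if j = i then x $ j else 1)"
        unfolding monomial_def by (intro prod.cong) auto
      then show "monomial (\<lambda>j. if j = i then 1 else 0 :: nat) x = x $ i" by simp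
    qed
    ultimately show ?thesis by simp
  qed
  have "g x = (\<Sum>i\<in>UNIV. g (axis i 1) * (x $ i))" for x
  proof -
    have "g x = g (\<Sum>i\<in>UNIV. (x $ i) *s axis i 1)"
      by (simp only: basis_expansion)
    also have "\<dots> = (\<Sum>i\<in>UNIV. g ((x $ i) *s axis i 1))"
      by (rule linear_sum[OF assms])
    finally show ?thesis
      by (simp add: scalar_mult_eq_scaleR linear_cmul[OF assms] mult.commute)
  qed
  then have g: "(\<lambda>x. \<Sum>i\<in>UNIV. g (axis i 1) * (x $ i)) = g"
    by (intro ext) (rule sym)
  have "polynomial_deg_le 1 (\<lambda>x. \<Sum>i\<in>UNIV. g (axis i 1) * (x $ i))"
    by (rule polynomial_deg_le_sum, rule polynomial_deg_le_cmul, rule coord)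
  then show ?thesis unfolding g .
qed

section \<open>Continuity, derivatives and local Lipschitz bounds of polynomials\<close>

lemma polynomial_deg_le_continuous_on:
  assumes "polynomial_deg_le k f"
  shows "continuous_on S f"
  using assms by (auto simp: polynomial_deg_le_def intro!: continuous_intros)

lemma polynomial_deg_le_borel_measurable:
  assumes "polynomial_deg_le k f"
  shows "f \<in> borel_measurable borel"
  using polynomial_deg_le_continuous_on[OF assms] by (rule borel_measurable_continuous_onI)

text \<open>For \<open>\<alpha> i = 0\<close> the truncated exponent \<open>\<alpha> i - 1\<close>
  is wrong but harmless, since the factor \<open>real (\<alpha> i)\<close> removes the term.\<close>

lemma monomial_has_derivative:
  fixes x :: "real^'d"
  shows "(monomial \<alpha> has_derivative
    (\<lambda>h. \<Sum>i\<in>UNIV. h $ i * (real (\<alpha> i) * monomial (\<alpha>(i := \<alpha> i - 1)) x))) (at x)"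
proof -
  have rest: "monomial (\<alpha>(i := \<alpha> i - 1)) x = x $ i ^ (\<alpha> i - 1) * (\<Prod>j\<in>UNIV - {i}. x $ j ^ \<alpha> j)" for i
    by (simp add: monomial_def prod.remove[of UNIV i])
  have "((\<lambda>x. \<Prod>i\<in>UNIV. (x $ i) ^ \<alpha> i) has_derivative
    (\<lambda>h. \<Sum>i\<in>UNIV. (of_nat (\<alpha> i) * h $ i * x $ i ^ (\<alpha> i - 1)) * (\<Prod>j\<in>UNIV - {i}. x $ j ^ \<alpha> j))) (at x)"
    by (intro has_derivative_prod has_derivative_power bounded_linear_imp_has_derivative
        bounded_linear_vec_nth)
  moreover have "(\<lambda>x. \<Prod>i\<in>UNIV. (x $ i) ^ \<alpha> i) = monomial \<alpha>"
    by (simp add: monomial_def fun_eq_iff)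
  ultimately show ?thesis
    unfolding rest by (simp add: mult_ac)
qed

text \<open>At \<open>k = 0\<close> the truncated bound \<open>k - 1\<close> would only say that the
  partial derivatives are constant. The extra clause records that they vanish, which the second
  derivatives in the case \<open>p = 0\<close> rely on.\<close>

lemma polynomial_deg_le_has_derivative:
  fixes f :: "real^'d \<Rightarrow> real"
  assumes "polynomial_deg_le k f"
  shows "\<exists>D. (\<forall>i. polynomial_deg_le (k - 1) (D i) \<and> (k = 0 \<longrightarrow> D i = (\<lambda>x. 0))) \<and>
    (\<forall>x. (f has_derivative (\<lambda>h. \<Sum>i\<in>UNIV. h $ i * D i x)) (at x))"
proof -
  obtain c where f: "f = (\<lambda>x. \<Sum>\<alpha>\<in>multi_indices k. c \<alpha> * monomial \<alpha> x)"
    using assms unfolding polynomial_deg_le_iff by blast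
  define D where "D i x = (\<Sum>\<alpha>\<in>multi_indices k. c \<alpha> * (real (\<alpha> i) * monomial (\<alpha>(i := \<alpha> i - 1)) x))" for i x
  show ?thesis
  proof (intro exI[of _ D] conjI allI impI)
    show "polynomial_deg_le (k - 1) (D i)" for i
      unfolding D_def
    proof (rule polynomial_deg_le_sum, rule polynomial_deg_le_cmul)
      fix \<alpha> :: "'d \<Rightarrow> nat" assume \<alpha>: "\<alpha> \<in> multi_indices k"
      show "polynomial_deg_le (k - 1) (\<lambda>x. real (\<alpha> i) * monomial (\<alpha>(i := \<alpha> i - 1)) x)"
      \<comment> \<open>If \<open>\<alpha> i = 0\<close>, the lowered index is
        \<open>\<alpha>\<close> itself and may still have order \<open>k\<close>; the zero
        coefficient is what saves the degree.\<close>
      proof (cases "\<alpha> i = 0")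
        case True
        then show ?thesis by (simp add: polynomial_deg_le_zero)
      next
        case False
        have "(\<Sum>j\<in>UNIV. (\<alpha>(i := \<alpha> i - 1)) j) = (\<alpha> i - 1) + (\<Sum>j\<in>UNIV - {i}. \<alpha> j)"
          by (simp add: sum.remove[of UNIV i])
        moreover have "(\<Sum>j\<in>UNIV. \<alpha> j) = \<alpha> i + (\<Sum>j\<in>UNIV - {i}. \<alpha> j)"
          by (simp add: sum.remove[of UNIV i])
        ultimately have "\<alpha>(i := \<alpha> i - 1) \<in> multi_indices (k - 1)"
          using \<alpha> False by (simp add: multi_indices_def)
        then show ?thesis
          by (intro polynomial_deg_le_cmul polynomial_deg_le_monomial)
      qed
    qed
    show "D i = (\<lambda>x. 0)" if "k = 0" for i
      using that by (auto simp: D_def fun_eq_iff multi_indices_def intro!: sum.neutral)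
    show "(f has_derivative (\<lambda>h. \<Sum>i\<in>UNIV. h $ i * D i x)) (at x)" for x
    proof -
      have "(f has_derivative (\<lambda>h. \<Sum>\<alpha>\<in>multi_indices k. c \<alpha> *
          (\<Sum>i\<in>UNIV. h $ i * (real (\<alpha> i) * monomial (\<alpha>(i := \<alpha> i - 1)) x)))) (at x)"
        unfolding f by (intro has_derivative_sum has_derivative_mult_right monomial_has_derivative)
      moreover have "(\<Sum>\<alpha>\<in>multi_indices k. c \<alpha> *
          (\<Sum>i\<in>UNIV. h $ i * (real (\<alpha> i) * monomial (\<alpha>(i := \<alpha> i - 1)) x)))
        = (\<Sum>i\<in>UNIV. h $ i * D i x)" for h
        unfolding D_def sum_distrib_left by (subst sum.swap) (simp add: mult_ac)
      ultimately show ?thesis by simp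
    qed
  qed
qed

lemma polynomial_deg_le_partial:
  fixes f :: "real^'d \<Rightarrow> real"
  assumes "(f has_derivative (\<lambda>h. \<Sum>j\<in>UNIV. h $ j * D j x)) (at x)"
  shows "((\<lambda>t. f (x + t *\<^sub>R axis i 1)) has_real_derivative D i x) (at 0)"
proof -
  have "((\<lambda>t. x + t *\<^sub>R axis i 1) has_derivative (\<lambda>t. t *\<^sub>R axis i 1)) (at (0::real))"
    by (auto intro!: derivative_eq_intros)
  then have "((\<lambda>t. f (x + t *\<^sub>R axis i 1)) has_derivative
      (\<lambda>t. \<Sum>j\<in>UNIV. (t *\<^sub>R axis i 1) $ j * D j x)) (at 0)"
    by (rule has_derivative_compose) (simp add: assms)
  moreover have "(\<Sum>j\<in>UNIV. (t *\<^sub>R axis i 1) $ j * D j x) = D i x * t" for t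
  proof -
    have "(\<Sum>j\<in>UNIV. (t *\<^sub>R axis i 1) $ j * D j x) = (\<Sum>j\<in>UNIV. if j = i then t * D j x else 0)"
      by (intro sum.cong) (auto simp: axis_def)
    then show ?thesis by simp
  qed
  ultimately show ?thesis
    by (simp add: has_field_derivative_def)
qed

text \<open>Compactness of the ball bounds the partial derivatives, and convexity turns this into a
  Lipschitz bound by the mean value inequality.\<close>

lemma polynomial_deg_le_lipschitz_cball:
  fixes f :: "real^'d \<Rightarrow> real"
  assumes "polynomial_deg_le k f"
  obtains M where "M-lipschitz_on (cball z R) f"
proof -
  obtain D where D: "\<And>i. polynomial_deg_le (k - 1) (D i)" 
    "\<And>x. (f has_derivative (\<lambda>h. \<Sum>i\<in>UNIV. h $ i * D i x)) (at x)"
    using polynomial_deg_le_has_derivative[OF assms] by blast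
  have "\<exists>B. \<forall>x\<in>cball z R. norm (D i x) \<le> B" for i
    using compact_imp_bounded[OF compact_continuous_image[OF polynomial_deg_le_continuous_on[OF D(1)] compact_cball]]
    by (auto simp: bounded_iff)
  then have "\<exists>B. \<forall>i. \<forall>x\<in>cball z R. norm (D i x) \<le> B i"
    by (intro choice allI)
  then obtain B where B: "\<And>i x. x \<in> cball z R \<Longrightarrow> norm (D i x) \<le> B i"
    by blast
  show thesis
  proof
    have B0: "0 \<le> sum B UNIV" if "x \<in> cball z R" for x
      by (intro sum_nonneg order_trans[OF norm_ge_zero B[OF that]])
    \<comment> \<open>For negative \<open>R\<close> the ball is empty and \<open>B\<close> is
      arbitrary, so the constant is cut off at 0.\<close>
    show "(max 0 (sum B UNIV))-lipschitz_on (cball z R) f"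
    proof (rule lipschitz_onI)
      fix x y assume xy: "x \<in> cball z R" "y \<in> cball z R"
      have "norm (f x - f y) \<le> sum B UNIV * norm (x - y)"
      proof (rule differentiable_bound[OF convex_cball _ _ xy])
        show "(f has_derivative (\<lambda>h. \<Sum>i\<in>UNIV. h $ i * D i u)) (at u within cball z R)" for u
          using D(2) by (rule has_derivative_at_withinI)
        show "onorm (\<lambda>h. \<Sum>i\<in>UNIV. h $ i * D i u) \<le> sum B UNIV" if "u \<in> cball z R" for u
        proof (rule onorm_bound[OF B0[OF that]])
          fix h :: "real^'d"
          have "norm (h $ i * D i u) \<le> norm h * B i" for i
            unfolding norm_mult real_norm_def[of "h $ i"]
            by (intro mult_mono component_le_norm_cart B[OF that] norm_ge_zero)
          then have "norm (\<Sum>i\<in>UNIV. h $ i * D i u) \<le> (\<Sum>i\<in>UNIV. norm h * B i)"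
            by (rule sum_norm_le)
          then show "norm (\<Sum>i\<in>UNIV. h $ i * D i u) \<le> sum B UNIV * norm h"
            by (simp add: sum_distrib_left mult.commute)
        qed
      qed
      then show "dist (f x) (f y) \<le> max 0 (sum B UNIV) * dist x y"
        by (simp add: dist_norm max_def B0[OF xy(1)])
    qed simp
  qed
qed

section \<open>The hat function\<close>

text \<open>The edge vectors from \<open>z\<close> to the other vertices are linearly independent,
  so the value 1 can be prescribed on all of them.\<close>

lemma simplex_barycentric_functional:
  fixes K :: "'a::euclidean_space set"
  assumes "n simplex K" "z extreme_point_of K"
  obtains \<mu> :: "'a \<Rightarrow> real" where "linear \<mu>"
    "\<And>v. v extreme_point_of K \<Longrightarrow> v \<noteq> z \<Longrightarrow> \<mu> (v - z) = 1"
proof -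
  obtain C where C: "\<not> affine_dependent C" "K = convex hull C"
    using assms(1) unfolding simplex by blast
  then have "z \<in> C"
    using assms(2) extreme_point_of_convex_hull by blast
  then have "independent ((\<lambda>x. - z + x) ` (C - {z}))"
    using C(1) affine_dependent_iff_dependent2 by blast
  from real_vector.linear_independent_extend[OF this, of "\<lambda>_. 1 :: real"]
  obtain \<mu> :: "'a \<Rightarrow> real" where \<mu>: "linear \<mu>" "\<And>v. v \<in> C - {z} \<Longrightarrow> \<mu> (- z + v) = 1"
    unfolding linear_def by blast
  show thesis
    using \<mu> extreme_point_of_convex_hull[of _ C] unfolding C(2)[symmetric]
    by (intro that[of \<mu>]) auto
qed

lemma linear_le_on_convex_hull:
  fixes \<mu> :: "'a::euclidean_space \<Rightarrow> real"
  assumes "linear \<mu>" "\<And>v. v \<in> V \<Longrightarrow> \<mu> v \<le> b" "x \<in> convex hull V"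
  shows "\<mu> x \<le> b"
proof -
  have "convex (\<mu> -` {..b})"
    by (rule convex_linear_vimage[OF assms(1)]) simp
  then have "convex hull V \<subseteq> \<mu> -` {..b}"
    by (intro hull_minimal) (use assms(2) in auto)
  then show ?thesis using assms(3) by auto
qed

text \<open>The functional \<open>\<mu>\<close> is the sum of the barycentric coordinates other than that of \<open>z\<close>, so
  that the hat function is \<open>1 - \<mu>\<close> on the simplex.\<close>

locale simplicial_star =
  fixes \<K> :: "'a::euclidean_space set set" and z :: 'a and \<mu> :: "'a set \<Rightarrow> 'a \<Rightarrow> real"
  assumes finite_star: "finite \<K>"
    and simplex_star: "\<And>K. K \<in> \<K> \<Longrightarrow> \<exists>n. n simplex K"
    and face_star: "\<And>K K'. K \<in> \<K> \<Longrightarrow> K' \<in> \<K> \<Longrightarrow> K \<inter> K' face_of K"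
    and apex: "\<And>K. K \<in> \<K> \<Longrightarrow> z extreme_point_of K"
    and apex_interior: "z \<in> interior (\<Union>\<K>)"
    and linear_\<mu>: "\<And>K. K \<in> \<K> \<Longrightarrow> linear (\<mu> K)"
    and \<mu>_vertex: "\<And>K v. K \<in> \<K> \<Longrightarrow> v extreme_point_of K \<Longrightarrow> v \<noteq> z \<Longrightarrow> \<mu> K (v - z) = 1"
begin

lemma star_convex_compact:
  assumes "K \<in> \<K>"
  shows "convex K" "compact K" "z \<in> K"
  using simplex_star[OF assms] apex[OF assms]
  by (auto simp: extreme_point_of_def simplex_def compact_convex_hull aff_independent_finite finite_imp_compact)

text \<open>Relative to \<open>z\<close> the functional is 0 at \<open>z\<close> and 1 at the other
  vertices, and the simplex is the hull of its vertices.\<close>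

lemma \<mu>_bounds:
  assumes "K \<in> \<K>" "x \<in> K"
  shows "0 \<le> \<mu> K (x - z)" "\<mu> K (x - z) \<le> 1"
proof -
  define V where "V = {v. v extreme_point_of K}"
  have x: "x \<in> convex hull V"
    using Krein_Milman_Minkowski[of K] star_convex_compact[OF assms(1)] assms(2)
    unfolding V_def by blast
  have V: "\<mu> K v = \<mu> K z \<or> \<mu> K v = 1 + \<mu> K z" if "v \<in> V" for v
    using \<mu>_vertex[OF assms(1), of v] that linear_diff[OF linear_\<mu>[OF assms(1)], of v z]
    by (cases "v = z") (auto simp: V_def)
  have "\<mu> K x \<le> 1 + \<mu> K z"
    by (rule linear_le_on_convex_hull[OF linear_\<mu>[OF assms(1)] _ x]) (use V in fastforce)
  then show "\<mu> K (x - z) \<le> 1"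
    by (simp add: linear_diff[OF linear_\<mu>[OF assms(1)]])
  have "- \<mu> K x \<le> - \<mu> K z"
    by (rule linear_le_on_convex_hull[OF _ _ x]) (use V linear_\<mu>[OF assms(1)] in \<open>fastforce intro: linear_compose_neg\<close>)+
  then show "0 \<le> \<mu> K (x - z)"
    by (simp add: linear_diff[OF linear_\<mu>[OF assms(1)]])
qed

text \<open>Conformity makes the pieces fit: the extreme points of the common face are vertices of
  both simplices, so both functionals are 0 at \<open>z\<close> and 1 at the others, and agreement
  spreads over the hull.\<close>

lemma \<mu>_consistent:
  assumes "K \<in> \<K>" "K' \<in> \<K>" "x \<in> K" "x \<in> K'"
  shows "\<mu> K (x - z) = \<mu> K' (x - z)"
proof -
  define V where "V = {v. v extreme_point_of (K \<inter> K')}"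
  have face: "K \<inter> K' face_of K" "K \<inter> K' face_of K'"
    using face_star[of K K'] face_star[of K' K] assms by (simp_all add: Int_commute)
  have "K \<inter> K' = convex hull V"
    unfolding V_def using star_convex_compact assms
    by (intro Krein_Milman_Minkowski compact_Int convex_Int) auto
  then have x: "x \<in> convex hull V" using assms by blast
  have V: "\<mu> K v - \<mu> K' v = \<mu> K z - \<mu> K' z" if "v \<in> V" for v
  proof (cases "v = z")
    case False
    have "v extreme_point_of K" "v extreme_point_of K'"
      using that face extreme_point_of_face unfolding V_def by blast+
    with False show ?thesis
      using \<mu>_vertex[of K v] \<mu>_vertex[of K' v] assms
      by (simp add: linear_diff[OF linear_\<mu>])
  qed simp
  have lin: "linear (\<lambda>x. \<mu> K x - \<mu> K' x)" "linear (\<lambda>x. \<mu> K' x - \<mu> K x)"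
    using linear_\<mu> assms by (simp_all add: linear_compose_sub)
  have "\<mu> K x - \<mu> K' x \<le> \<mu> K z - \<mu> K' z"
    by (rule linear_le_on_convex_hull[OF lin(1) _ x]) (use V in fastforce)
  moreover have "\<mu> K' x - \<mu> K x \<le> \<mu> K' z - \<mu> K z"
    by (rule linear_le_on_convex_hull[OF lin(2) _ x]) (use V in fastforce)
  ultimately show ?thesis
    using assms by (simp add: linear_diff[OF linear_\<mu>])
qed

lemma \<mu>_scale:
  assumes "K \<in> \<K>"
  shows "\<mu> K (z + \<epsilon> *\<^sub>R (x - z) - z) = \<epsilon> * \<mu> K (x - z)"
  using linear_cmul[OF linear_\<mu>[OF assms]] by simp

lemma scale_mem:
  assumes "K \<in> \<K>" "z + \<epsilon> *\<^sub>R (x - z) \<in> K" "0 \<le> \<delta>" "\<delta> \<le> \<epsilon>"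
  shows "z + \<delta> *\<^sub>R (x - z) \<in> K"
proof (cases "\<epsilon> = 0")
  case False
  have "(1 - \<delta> / \<epsilon>) *\<^sub>R z + (\<delta> / \<epsilon>) *\<^sub>R (z + \<epsilon> *\<^sub>R (x - z)) \<in> K"
    using assms star_convex_compact[OF assms(1)] False
    by (intro convexD_alt) (auto simp: divide_le_eq)
  also have "(1 - \<delta> / \<epsilon>) *\<^sub>R z + (\<delta> / \<epsilon>) *\<^sub>R (z + \<epsilon> *\<^sub>R (x - z)) = z + \<delta> *\<^sub>R (x - z)"
    using False by (simp add: algebra_simps)
  finally show ?thesis .
qed (use assms in auto)

text \<open>In barycentric coordinates the weights of the vertices other than \<open>z\<close> add
  up to the value of \<open>\<mu>\<close>. Undoing the factor \<epsilon> divides these weights by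
  \<epsilon> and leaves \<open>1 - \<mu> K (x - z)\<close> for \<open>z\<close>, which is
  nonnegative by hypothesis. Hence, within its cone, \<open>K\<close> is exactly the sublevel set of
  \<open>\<mu>\<close> at 1.\<close>

lemma mem_of_\<mu>_le_1:
  assumes "K \<in> \<K>" "\<epsilon> > 0" "z + \<epsilon> *\<^sub>R (x - z) \<in> K" "\<mu> K (x - z) \<le> 1"
  shows "x \<in> K"
proof -
  define C where "C = {v. v extreme_point_of K}"
  have K: "K = convex hull C"
    using Krein_Milman_Minkowski[of K] star_convex_compact[OF assms(1)] unfolding C_def by blast
  have fin: "finite C"
    using simplex_star[OF assms(1)] finite_polyhedron_extreme_points simplex_imp_polyhedron
    unfolding C_def by blast
  obtain u where u: "\<And>v. v \<in> C \<Longrightarrow> 0 \<le> u v" "sum u C = 1" "(\<Sum>v\<in>C. u v *\<^sub>R v) = z + \<epsilon> *\<^sub>R (x - z)"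
    using assms(3) unfolding K convex_hull_finite[OF fin] by auto
  have zC: "z \<in> C" using apex[OF assms(1)] by (simp add: C_def)
  have uz: "u z = 1 - sum u (C - {z})"
    using u(2) sum.remove[OF fin zC, of u] by simp
  \<comment> \<open>Measured from \<open>z\<close>, the term of \<open>z\<close> drops out, so only
    the other weights carry information.\<close>
  have "(\<Sum>v\<in>C. u v *\<^sub>R (v - z)) = \<epsilon> *\<^sub>R (x - z)"
    using u by (simp add: scaleR_right_diff_distrib sum_subtractf flip: scaleR_sum_left)
  then have rep: "(\<Sum>v\<in>C - {z}. u v *\<^sub>R (v - z)) = \<epsilon> *\<^sub>R (x - z)"
    by (simp add: sum.remove[OF fin zC])
  have "\<epsilon> * \<mu> K (x - z) = \<mu> K (\<Sum>v\<in>C - {z}. u v *\<^sub>R (v - z))"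
    using rep linear_cmul[OF linear_\<mu>[OF assms(1)]] by simp
  also have "\<dots> = (\<Sum>v\<in>C - {z}. u v * \<mu> K (v - z))"
    using linear_\<mu>[OF assms(1)] by (simp add: linear_sum linear_cmul)
  also have "\<dots> = sum u (C - {z})"
    using \<mu>_vertex[OF assms(1)] by (intro sum.cong) (auto simp: C_def)
  finally have sum: "sum u (C - {z}) = \<epsilon> * \<mu> K (x - z)" by simp
  define w where "w v = (if v = z then 1 - \<mu> K (x - z) else u v / \<epsilon>)" for v
  have "(\<Sum>v\<in>C - {z}. w v *\<^sub>R (v - z)) = (1 / \<epsilon>) *\<^sub>R (\<Sum>v\<in>C - {z}. u v *\<^sub>R (v - z))"
    unfolding scaleR_sum_right by (intro sum.cong) (auto simp: w_def)
  also have "\<dots> = x - z"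
    unfolding rep using assms(2) by simp
  finally have "(\<Sum>v\<in>C. w v *\<^sub>R (v - z)) = x - z"
    by (simp add: sum.remove[OF fin zC])
  moreover have w1: "sum w C = 1"
  proof -
    have "sum w (C - {z}) = (\<Sum>v\<in>C - {z}. u v / \<epsilon>)"
      by (intro sum.cong) (auto simp: w_def)
    also have "\<dots> = \<mu> K (x - z)"
      using sum assms(2) by (simp flip: sum_divide_distrib)
    finally show ?thesis
      by (simp add: sum.remove[OF fin zC] w_def)
  qed
  ultimately have "(\<Sum>v\<in>C. w v *\<^sub>R v) = x"
    by (simp add: scaleR_right_diff_distrib sum_subtractf flip: scaleR_sum_left)
  moreover have "0 \<le> w v" if "v \<in> C" for v
    using u(1)[OF that] assms by (simp add: w_def)
  ultimately show ?thesis
    unfolding K convex_hull_finite[OF fin] using w1 by blast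
qed

text \<open>\<open>star_gauge\<close> extends \<open>\<mu>\<close> homogeneously to the whole space, which the cones over the simplices
  cover; the hat function is its truncation.\<close>

definition star_gauge :: "'a \<Rightarrow> real" where
  "star_gauge x = \<mu> (SOME K. K \<in> \<K> \<and> (\<exists>\<epsilon>>0. z + \<epsilon> *\<^sub>R (x - z) \<in> K)) (x - z)"

definition hat :: "'a \<Rightarrow> real" where
  "hat x = max 0 (1 - star_gauge x)"

text \<open>The choice made by \<open>SOME\<close> does not matter: a common smaller factor \<delta>
  moves the point into both simplices, where the functionals agree, and \<delta> cancels by
  linearity.\<close>

lemma star_gauge_eq:
  assumes "K \<in> \<K>" "\<epsilon> > 0" "z + \<epsilon> *\<^sub>R (x - z) \<in> K"
  shows "star_gauge x = \<mu> K (x - z)"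
proof -
  define K' where "K' = (SOME K. K \<in> \<K> \<and> (\<exists>\<epsilon>>0. z + \<epsilon> *\<^sub>R (x - z) \<in> K))"
  have "K' \<in> \<K> \<and> (\<exists>\<epsilon>>0. z + \<epsilon> *\<^sub>R (x - z) \<in> K')"
    unfolding K'_def by (rule someI_ex) (use assms in blast)
  then obtain \<epsilon>' where K': "K' \<in> \<K>" "\<epsilon>' > 0" "z + \<epsilon>' *\<^sub>R (x - z) \<in> K'" by blast
  define \<delta> where "\<delta> = min \<epsilon> \<epsilon>'"
  have \<delta>: "\<delta> > 0" "z + \<delta> *\<^sub>R (x - z) \<in> K" "z + \<delta> *\<^sub>R (x - z) \<in> K'"
    using assms K' scale_mem[of K \<epsilon> x \<delta>] scale_mem[of K' \<epsilon>' x \<delta>] by (auto simp: \<delta>_def)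
  have "\<delta> * \<mu> K (x - z) = \<delta> * \<mu> K' (x - z)"
    using \<mu>_consistent[OF assms(1) K'(1) \<delta>(2,3)] \<mu>_scale assms(1) K'(1) by metis
  then show ?thesis
    using \<delta>(1) by (simp add: star_gauge_def K'_def)
qed

text \<open>A ball around \<open>z\<close> lies in the star, so a single factor serves a whole
  bounded set, in particular a segment.\<close>

lemma scale_into_star:
  assumes "bounded S"
  obtains \<epsilon> where "\<epsilon> > 0" "\<And>x. x \<in> S \<Longrightarrow> z + \<epsilon> *\<^sub>R (x - z) \<in> \<Union>\<K>"
proof -
  obtain r where r: "r > 0" "ball z r \<subseteq> \<Union>\<K>"
    using apex_interior mem_interior by blast
  obtain B where B: "B > 0" "\<And>x. x \<in> S \<Longrightarrow> dist z x < B"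
    using assms bounded_subset_ballD[of S z] by (metis mem_ball subsetD)
  show thesis
  proof
    show "r / B > 0" using r B by simp
    show "z + (r / B) *\<^sub>R (x - z) \<in> \<Union>\<K>" if "x \<in> S" for x
    proof -
      have "r * norm (x - z) < r * B"
        using B(2)[OF that] r(1) by (simp add: dist_norm norm_minus_commute)
      then have "z + (r / B) *\<^sub>R (x - z) \<in> ball z r"
        using r B(1) by (simp add: dist_norm divide_less_eq)
      then show ?thesis using r(2) by blast
    qed
  qed
qed

text \<open>Along a segment scaled into the star, the parameter interval is covered by finitely many
  closed sets, on each of which the gauge is linear. Lipschitz bounds with a common constant on such
  a cover glue along an interval.\<close>

lemma star_gauge_lipschitz:
  obtains L where "L-lipschitz_on UNIV star_gauge"
proof -
  \<comment> \<open>The sum dominates each single operator norm, so one constant fits all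
    pieces.\<close>
  define L where "L = (\<Sum>K\<in>\<K>. onorm (\<mu> K))"
  have onorm_nonneg: "0 \<le> onorm (\<mu> K)" if "K \<in> \<K>" for K
    using that linear_\<mu> by (intro onorm_pos_le) (simp add: linear_conv_bounded_linear)
  have L0: "L \<ge> 0" unfolding L_def by (rule sum_nonneg) (rule onorm_nonneg)
  have \<mu>_le: "\<bar>\<mu> K x\<bar> \<le> L * norm x" if "K \<in> \<K>" for K x
  proof -
    have "\<bar>\<mu> K x\<bar> \<le> onorm (\<mu> K) * norm x"
      using that linear_\<mu> onorm[of "\<mu> K" x] by (simp add: linear_conv_bounded_linear)
    also have "\<dots> \<le> L * norm x"
      unfolding L_def using that finite_star onorm_nonneg
      by (intro mult_right_mono member_le_sum) auto
    finally show ?thesis .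
  qed
  show thesis
  proof (rule that, rule lipschitz_onI)
    fix x y :: 'a
    define p where "p t = x + t *\<^sub>R (y - x)" for t :: real
    have "bounded (p ` {0..1})"
      unfolding p_def
      by (intro compact_imp_bounded compact_continuous_image continuous_intros) simp
    then obtain \<epsilon> where \<epsilon>: "\<epsilon> > 0" "\<And>t. t \<in> {0..1} \<Longrightarrow> z + \<epsilon> *\<^sub>R (p t - z) \<in> \<Union>\<K>"
      using scale_into_star by (metis imageI)
    \<comment> \<open>The parameters whose scaled point lies in \<open>K\<close>, that is, the part
      of the segment in the cone over \<open>K\<close> seen through \<epsilon>.\<close>
    define U where "U K = (\<lambda>t. z + \<epsilon> *\<^sub>R (p t - z)) -` K" for K
    have "(L * norm (y - x))-lipschitz_on {0..1} (\<lambda>t. star_gauge (p t))"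
    proof (rule lipschitz_on_closed_Union[of \<K> _ U])
      fix K assume K: "K \<in> \<K>"
      have eq: "star_gauge (p t) = \<mu> K (p t - z)" if "t \<in> U K" for t
        using star_gauge_eq[OF K \<epsilon>(1)] that by (simp add: U_def)
      show "(L * norm (y - x))-lipschitz_on (U K) (\<lambda>t. star_gauge (p t))"
      proof (rule lipschitz_onI)
        fix s t assume st: "s \<in> U K" "t \<in> U K"
        have "star_gauge (p s) - star_gauge (p t) = \<mu> K ((s - t) *\<^sub>R (y - x))"
          unfolding eq[OF st(1)] eq[OF st(2)] linear_diff[OF linear_\<mu>[OF K], symmetric]
          by (simp add: p_def algebra_simps)
        then have "\<bar>star_gauge (p s) - star_gauge (p t)\<bar> \<le> L * norm ((s - t) *\<^sub>R (y - x))"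
          using \<mu>_le[OF K] by metis
        then show "dist (star_gauge (p s)) (star_gauge (p t)) \<le> L * norm (y - x) * dist s t"
          by (simp add: dist_real_def mult_ac)
      qed (use L0 in simp)
      show "closed (U K)"
        unfolding U_def p_def using star_convex_compact[OF K]
        by (intro continuous_closed_vimage compact_imp_closed continuous_intros) auto
    qed (use finite_star L0 \<epsilon>(2) in \<open>auto simp: U_def\<close>)
    from lipschitz_onD[OF this, of 0 1] show "dist (star_gauge x) (star_gauge y) \<le> L * dist x y"
      by (simp add: p_def dist_norm norm_minus_commute)
  qed (rule L0)
qed

lemma hat_lipschitz:
  obtains L where "L-lipschitz_on UNIV hat"
proof -
  obtain L where L: "L-lipschitz_on UNIV star_gauge" by (rule star_gauge_lipschitz)
  have "L-lipschitz_on UNIV hat"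
  proof (rule lipschitz_onI)
    show "dist (hat x) (hat y) \<le> L * dist x y" for x y
      using lipschitz_onD[OF L, of x y] by (auto simp: hat_def dist_real_def)
  qed (rule lipschitz_on_nonneg[OF L])
  then show thesis by (rule that)
qed

lemma hat_eq:
  assumes "K \<in> \<K>" "x \<in> K"
  shows "hat x = 1 - \<mu> K (x - z)"
  using star_gauge_eq[OF assms(1), of 1 x] \<mu>_bounds[OF assms] assms(2) by (simp add: hat_def)

text \<open>The point lies in the cone over some simplex but not in that simplex, so its gauge
  exceeds 1 and the truncation gives 0.\<close>

lemma hat_outside:
  assumes "x \<notin> \<Union>\<K>"
  shows "hat x = 0"
proof -
  obtain \<epsilon> where "\<epsilon> > 0" "z + \<epsilon> *\<^sub>R (x - z) \<in> \<Union>\<K>"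
    using scale_into_star[of "{x}"] by auto
  then obtain K where K: "K \<in> \<K>" "z + \<epsilon> *\<^sub>R (x - z) \<in> K" by blast
  then have "star_gauge x = \<mu> K (x - z)" "\<not> \<mu> K (x - z) \<le> 1"
    using star_gauge_eq mem_of_\<mu>_le_1 \<open>\<epsilon> > 0\<close> assms by blast+
  then show ?thesis by (simp add: hat_def)
qed

text \<open>An interior point can be pushed further away from \<open>z\<close> without leaving
  \<open>K\<close>. The push multiplies \<open>\<mu>\<close> by \<open>1 + \<delta>\<close> and
  still leaves it at most 1, so it was strictly below 1 before.\<close>

lemma hat_pos:
  assumes "K \<in> \<K>" "x \<in> interior K"
  shows "hat x > 0"
proof -
  obtain e where e: "e > 0" "ball x e \<subseteq> K"
    using assms(2) mem_interior by blast
  \<comment> \<open>The summand 1 keeps \<delta> positive when \<open>x = z\<close>.\<close>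
  define \<delta> where "\<delta> = e / (norm (x - z) + 1)"
  have \<delta>: "\<delta> > 0" using e(1) by (simp add: \<delta>_def add_nonneg_pos)
  have "\<delta> * norm (x - z) < e"
    using e(1) by (simp add: \<delta>_def divide_less_eq add_nonneg_pos distrib_left)
  then have "x + \<delta> *\<^sub>R (x - z) \<in> K"
    using e \<delta> by (intro subsetD[OF e(2)]) (simp add: dist_norm)
  then have "\<mu> K (x + \<delta> *\<^sub>R (x - z) - z) \<le> 1"
    by (rule \<mu>_bounds(2)[OF assms(1)])
  moreover have "x + \<delta> *\<^sub>R (x - z) - z = z + (1 + \<delta>) *\<^sub>R (x - z) - z"
    by (simp add: algebra_simps)
  ultimately have "(1 + \<delta>) * \<mu> K (x - z) \<le> 1"
    using \<mu>_scale[OF assms(1)] by metis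
  then have "\<mu> K (x - z) \<le> 1 / (1 + \<delta>)"
    using \<delta> by (simp add: le_divide_eq mult.commute)
  also have "\<dots> < 1"
    using \<delta> by simp
  finally have "\<mu> K (x - z) < 1" .
  then show ?thesis
    using hat_eq[OF assms(1)] assms(2) interior_subset by fastforce
qed

end

section \<open>Integration by parts without boundary terms\<close>

text \<open>The difference quotients of \<open>F\<close> in direction \<open>e\<close> have integral zero by translation
  invariance and converge dominatedly to \<open>F'\<close>.\<close>

lemma integral_directional_derivative_eq_0:
  fixes F F' w :: "'a::euclidean_space \<Rightarrow> real"
  assumes F: "integrable lborel F" and F': "F' \<in> borel_measurable borel"
    and w: "integrable lborel w"
    and bound: "\<And>x h. 0 < h \<Longrightarrow> h \<le> 1 \<Longrightarrow> \<bar>F (x + h *\<^sub>R e) - F x\<bar> \<le> h * w x"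
    and deriv: "AE x in lborel. ((\<lambda>t. F (x + t *\<^sub>R e)) has_real_derivative F' x) (at 0)"
  shows "integrable lborel F'" "integral\<^sup>L lborel F' = 0"
proof -
  \<comment> \<open>Dominated convergence is applied along a sequence; all these steps lie in the
    range where \<open>bound\<close> holds.\<close>
  define h where "h n = 1 / real (Suc n)" for n
  have h: "0 < h n" "h n \<le> 1" for n
    by (simp_all add: h_def)
  define G where "G n x = (F (x + h n *\<^sub>R e) - F x) / h n" for n x
  have Fm [measurable]: "F \<in> borel_measurable borel"
    using F by (simp add: borel_measurable_integrable)
  have Gm: "G n \<in> borel_measurable lborel" for n
    unfolding G_def by measurable
  have shift: "integrable lborel (\<lambda>x. F (x + c))" "(\<integral>x. F (x + c) \<partial>lborel) = integral\<^sup>L lborel F" for c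
  proof -
    have "integrable (distr lborel borel ((+) c)) F"
      using F by (simp add: lborel_distr_plus)
    then show "integrable lborel (\<lambda>x. F (x + c))"
      by (subst (asm) integrable_distr_eq) (simp_all add: add.commute)
    show "(\<integral>x. F (x + c) \<partial>lborel) = integral\<^sup>L lborel F"
      by (subst lborel_distr_plus[of c, symmetric], subst integral_distr) (simp_all add: add.commute)
  qed
  have Gint: "integral\<^sup>L lborel (G n) = 0" for n
    unfolding G_def using shift[of "h n *\<^sub>R e"] F by simp
  have lim: "AE x in lborel. (\<lambda>n. G n x) \<longlonglongrightarrow> F' x"
    using deriv
  proof eventually_elim
    case (elim x)
    have h0: "filterlim h (at 0) sequentially"
    proof (rule filterlim_atI)
      show "h \<longlonglongrightarrow> 0"
        unfolding h_def by (rule LIMSEQ_Suc[OF lim_1_over_n])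
      show "\<forall>\<^sub>F n in sequentially. h n \<noteq> 0"
        using h(1) by (intro always_eventually allI) (metis less_irrefl)
    qed
    have "((\<lambda>t. (F (x + t *\<^sub>R e) - F x) / t) \<longlongrightarrow> F' x) (at 0)"
      using elim by (simp add: has_field_derivative_iff)
    from filterlim_compose[OF this h0] show ?case
      by (simp add: G_def)
  qed
  have bd: "AE x in lborel. norm (G n x) \<le> w x" for n
    using bound[OF h, of _ n] h(1)[of n]
    by (intro always_eventually allI) (simp add: G_def divide_le_eq mult.commute)
  have F'': "F' \<in> borel_measurable lborel" using F' by simp
  show "integrable lborel F'"
    by (rule integrable_dominated_convergence[OF F'' Gm w lim bd])
  have "(\<lambda>n. integral\<^sup>L lborel (G n)) \<longlonglongrightarrow> integral\<^sup>L lborel F'"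
    by (rule integral_dominated_convergence[OF F'' Gm w lim bd])
  then show "integral\<^sup>L lborel F' = 0"
    unfolding Gint by (simp add: LIMSEQ_const_iff)
qed

lemma integrable_lborel_indicator_continuous:
  fixes g :: "'a::euclidean_space \<Rightarrow> real"
  assumes "S \<in> sets borel" "bounded S" "continuous_on UNIV g"
  shows "integrable lborel (\<lambda>x. indicator S x * g x)"
proof -
  have "integrable lborel (\<lambda>x. indicator (closure S) x *\<^sub>R g x)"
    using assms by (intro borel_integrable_compact continuous_on_subset[OF assms(3)]) auto
  then have "integrable lborel (\<lambda>x. indicator S x *\<^sub>R (indicator (closure S) x *\<^sub>R g x))"
    by (rule integrable_mult_indicator[rotated]) (use assms(1) in simp)
  moreover have "(\<lambda>x. indicator S x *\<^sub>R (indicator (closure S) x *\<^sub>R g x)) = (\<lambda>x. indicator S x * g x)"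
    using closure_subset[of S] by (intro ext) (auto simp: indicator_def)
  ultimately show ?thesis by simp
qed

text \<open>Provides the integrability and the majorant that
  \<open>integral_directional_derivative_eq_0\<close> asks for. The difference is nonzero only if
  one of the two points lies in the support ball of \<phi>, so a Lipschitz bound for
  \<open>g\<close> on a larger ball suffices, as is available for polynomials.\<close>

lemma lipschitz_mult_compact_support:
  fixes \<phi> g :: "'a::euclidean_space \<Rightarrow> real"
  assumes \<phi>: "L-lipschitz_on UNIV \<phi>" "\<And>x. x \<notin> cball z R \<Longrightarrow> \<phi> x = 0"
    and g: "M-lipschitz_on (cball z (R + 2 * norm e)) g" "continuous_on UNIV g"
  shows "integrable lborel (\<lambda>x. \<phi> x * g x)"
    and "\<exists>w. integrable lborel w \<and>
      (\<forall>x h. 0 < h \<longrightarrow> h \<le> 1 \<longrightarrow> \<bar>\<phi> (x + h *\<^sub>R e) * g (x + h *\<^sub>R e) - \<phi> x * g x\<bar> \<le> h * w x)"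
proof -
  have \<phi>c: "continuous_on UNIV \<phi>" by (rule lipschitz_on_continuous_on[OF \<phi>(1)])
  \<comment> \<open>If \<open>x\<close> or \<open>x + h *\<^sub>R e\<close> is in
    \<open>cball z R\<close>, then \<open>x\<close> is within \<open>R + norm e\<close> of
    \<open>z\<close>, and its translate within one more \<open>norm e\<close>.\<close>
  define r where "r = R + 2 * norm e"
  have bounded_on: "\<exists>B\<ge>0. \<forall>x\<in>cball z r. \<bar>u x\<bar> \<le> B" if "continuous_on UNIV u" for u :: "'a \<Rightarrow> real"
  proof -
    have "bounded (u ` cball z r)"
      by (intro compact_imp_bounded compact_continuous_image compact_cball
          continuous_on_subset[OF that]) simp
    then obtain B where "\<forall>x\<in>cball z r. \<bar>u x\<bar> \<le> B" by (auto simp: bounded_iff)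
    then show ?thesis by (intro exI[of _ "max 0 B"]) auto
  qed
  obtain A where A: "A \<ge> 0" "\<And>x. x \<in> cball z r \<Longrightarrow> \<bar>\<phi> x\<bar> \<le> A"
    using bounded_on[OF \<phi>c] by blast
  obtain B where B: "B \<ge> 0" "\<And>x. x \<in> cball z r \<Longrightarrow> \<bar>g x\<bar> \<le> B"
    using bounded_on[OF g(2)] by blast
  have zero: "\<phi> x = 0" if "x \<notin> cball z r" for x
    using that by (intro \<phi>(2)) (auto simp: r_def intro: order_trans)
  have "integrable lborel (\<lambda>x. indicator (cball z r) x * (\<phi> x * g x))"
    by (intro integrable_lborel_indicator_continuous continuous_on_mult \<phi>c g(2)) auto
  moreover have "indicator (cball z r) x * (\<phi> x * g x) = \<phi> x * g x" for x
    using zero[of x] by (cases "x \<in> cball z r") auto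
  ultimately show "integrable lborel (\<lambda>x. \<phi> x * g x)" by simp
  \<comment> \<open>From the product rule for differences: \<open>A\<close> bounds \<phi> against
    the increment of \<open>g\<close>, and \<open>B\<close> bounds \<open>g\<close> against the
    increment of \<phi>.\<close>
  define C where "C = A * (M * norm e) + (L * norm e) * B"
  have L: "L \<ge> 0" and M: "M \<ge> 0"
    using \<phi>(1) g(1) by (auto intro: lipschitz_on_nonneg)
  have "integrable lborel (\<lambda>x. indicator (cball z (R + norm e)) x * C)"
    by (intro integrable_lborel_indicator_continuous) auto
  moreover have "\<bar>\<phi> (x + h *\<^sub>R e) * g (x + h *\<^sub>R e) - \<phi> x * g x\<bar>
      \<le> h * (indicator (cball z (R + norm e)) x * C)" if h: "0 < h" "h \<le> 1" for x h
  proof -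
    have he: "h * norm e \<le> norm e"
      using h by (simp add: mult_left_le_one_le)
    have dist: "dist z (x + h *\<^sub>R e) \<le> dist z x + h * norm e" "dist z x \<le> dist z (x + h *\<^sub>R e) + h * norm e"
      using h dist_triangle[of z "x + h *\<^sub>R e" x] dist_triangle[of z x "x + h *\<^sub>R e"]
      by (simp_all add: dist_norm)
    show ?thesis
    proof (cases "x \<in> cball z (R + norm e)")
      case False
      then have "x \<notin> cball z R" "x + h *\<^sub>R e \<notin> cball z R"
        using dist he h norm_ge_zero[of e] by auto
      then show ?thesis using \<phi>(2) False by simp
    next
      case True
      then have mem: "x \<in> cball z r" "x + h *\<^sub>R e \<in> cball z r"
        using dist he norm_ge_zero[of e] by (auto simp: r_def)
      have "\<phi> (x + h *\<^sub>R e) * g (x + h *\<^sub>R e) - \<phi> x * g x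
          = \<phi> (x + h *\<^sub>R e) * (g (x + h *\<^sub>R e) - g x) + (\<phi> (x + h *\<^sub>R e) - \<phi> x) * g x"
        by (simp add: algebra_simps)
      also have "\<bar>\<dots>\<bar> \<le> A * (M * (h * norm e)) + (L * (h * norm e)) * B"
      proof (rule order_trans[OF abs_triangle_ineq], unfold abs_mult, intro add_mono mult_mono)
        show "\<bar>g (x + h *\<^sub>R e) - g x\<bar> \<le> M * (h * norm e)"
          using lipschitz_onD[OF g(1)[folded r_def] mem(2,1)] h by (simp add: dist_norm)
        show "\<bar>\<phi> (x + h *\<^sub>R e) - \<phi> x\<bar> \<le> L * (h * norm e)"
          using lipschitz_onD[OF \<phi>(1), of "x + h *\<^sub>R e" x] h by (simp add: dist_norm)
      qed (use A B mem L h in auto)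
      also have "\<dots> = h * C"
        by (simp add: C_def algebra_simps)
      finally show ?thesis using True by simp
    qed
  qed
  ultimately show "\<exists>w. integrable lborel w \<and>
      (\<forall>x h. 0 < h \<longrightarrow> h \<le> 1 \<longrightarrow> \<bar>\<phi> (x + h *\<^sub>R e) * g (x + h *\<^sub>R e) - \<phi> x * g x\<bar> \<le> h * w x)"
    by (intro exI[of _ "\<lambda>x. indicator (cball z (R + norm e)) x * C"]) blast
qed

text \<open>A nonzero value would persist on a nonempty open set, and such a set is not
  negligible.\<close>

lemma continuous_AE_zero_imp_zero:
  fixes d :: "'a::euclidean_space \<Rightarrow> real"
  assumes "open T" "continuous_on T d" "AE x in lborel. x \<in> T \<longrightarrow> d x = 0" "x \<in> T"
  shows "d x = 0"
proof (rule ccontr)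
  assume "d x \<noteq> 0"
  define U where "U = T \<inter> d -` (- {0})"
  have U: "open U"
    unfolding U_def by (rule continuous_open_preimage[OF assms(2,1)]) (simp add: open_Compl)
  have "AE x in lborel. x \<notin> U"
    using assms(3) by eventually_elim (auto simp: U_def)
  then have "AE x in lebesgue. x \<notin> U"
    by (rule AE_completion)
  then have "negligible U"
    using U by (simp add: negligible_iff_null_sets AE_iff_null_sets borel_open)
  then have "U = {}"
    using U open_not_negligible by blast
  then show False
    using \<open>d x \<noteq> 0\<close> assms(4) by (auto simp: U_def)
qed

section \<open>Orthogonal projection\<close>

text \<open>The inequality \<open>2 * \<bar>f * g\<bar> \<le> f^2 + g^2\<close> gives an integrable
  majorant.\<close>

lemma L2_mult_integrable:
  assumes "f \<in> L2_functions S" "g \<in> L2_functions S"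
  shows "integrable (lebesgue_on S) (\<lambda>x. f x * g x)"
proof (rule Bochner_Integration.integrable_bound)
  show "integrable (lebesgue_on S) (\<lambda>x. (f x)\<^sup>2 + (g x)\<^sup>2)"
    using assms by (simp add: L2_functions_def)
  show "(\<lambda>x. f x * g x) \<in> borel_measurable (lebesgue_on S)"
    using assms by (intro borel_measurable_times) (simp_all add: L2_functions_def)
  show "AE x in lebesgue_on S. norm (f x * g x) \<le> norm ((f x)\<^sup>2 + (g x)\<^sup>2)"
  proof (intro always_eventually allI)
    fix x
    have "2 * \<bar>f x * g x\<bar> \<le> (f x)\<^sup>2 + (g x)\<^sup>2"
      using sum_squares_bound[of "\<bar>f x\<bar>" "\<bar>g x\<bar>"] by (simp add: abs_mult)
    then show "norm (f x * g x) \<le> norm ((f x)\<^sup>2 + (g x)\<^sup>2)" by simp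
  qed
qed

lemma L2_functions_cmul:
  assumes "f \<in> L2_functions S"
  shows "(\<lambda>x. a * f x) \<in> L2_functions S"
proof -
  have [measurable]: "f \<in> borel_measurable (lebesgue_on S)"
    using assms by (simp add: L2_functions_def)
  have "(\<lambda>x. a * f x) \<in> borel_measurable (lebesgue_on S)" by measurable
  then show ?thesis
    using assms by (simp add: L2_functions_def power_mult_distrib)
qed

lemma L2_functions_add:
  assumes "f \<in> L2_functions S" "g \<in> L2_functions S"
  shows "(\<lambda>x. f x + g x) \<in> L2_functions S"
proof -
  have [measurable]: "f \<in> borel_measurable (lebesgue_on S)" "g \<in> borel_measurable (lebesgue_on S)"
    using assms by (simp_all add: L2_functions_def)
  have "(\<lambda>x. f x + g x) \<in> borel_measurable (lebesgue_on S)" by measurable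
  then show ?thesis
    using assms L2_mult_integrable[OF assms]
    by (simp add: L2_functions_def power2_sum mult.assoc)
qed

lemma L2_functions_diff:
  assumes "f \<in> L2_functions S" "g \<in> L2_functions S"
  shows "(\<lambda>x. f x - g x) \<in> L2_functions S"
  using L2_functions_add[OF assms(1) L2_functions_cmul[OF assms(2), of "-1"]] by simp

lemma L2_functions_sum:
  assumes "\<And>i. i \<in> I \<Longrightarrow> f i \<in> L2_functions S"
  shows "(\<lambda>x. \<Sum>i\<in>I. f i x) \<in> L2_functions S"
  using assms
proof (induction I rule: infinite_finite_induct)
  case (insert i I)
  then show ?case by (simp add: L2_functions_add)
qed (simp_all add: L2_functions_def)

lemma L2_inner_commute: "L2_inner S f g = L2_inner S g f"
  by (simp add: L2_inner_def mult.commute)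

lemma L2_inner_add_left:
  assumes "f \<in> L2_functions S" "g \<in> L2_functions S" "h \<in> L2_functions S"
  shows "L2_inner S (\<lambda>x. f x + g x) h = L2_inner S f h + L2_inner S g h"
  using assms by (simp add: L2_inner_def distrib_right L2_mult_integrable)

lemma L2_inner_cmul_left: "L2_inner S (\<lambda>x. a * f x) h = a * L2_inner S f h"
  by (simp add: L2_inner_def mult.assoc)

lemma L2_inner_diff_left:
  assumes "f \<in> L2_functions S" "g \<in> L2_functions S" "h \<in> L2_functions S"
  shows "L2_inner S (\<lambda>x. f x - g x) h = L2_inner S f h - L2_inner S g h"
  using assms by (simp add: L2_inner_def left_diff_distrib L2_mult_integrable)

lemma L2_inner_self_eq_0:
  assumes "f \<in> L2_functions S" "L2_inner S f f = 0"
  shows "AE x in lebesgue_on S. f x = 0"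
  using assms integral_nonneg_eq_0_iff_AE[OF L2_mult_integrable[OF assms(1,1)]]
  by (simp add: L2_inner_def)

text \<open>Covers the degenerate orthogonalisation step, in which the new generator agrees almost
  everywhere with an element of the span.\<close>

lemma L2_inner_eq_0:
  assumes "f \<in> L2_functions S" "L2_inner S f f = 0"
  shows "L2_inner S f g = 0"
  unfolding L2_inner_def
  by (rule integral_eq_zero_AE) (use L2_inner_self_eq_0[OF assms] in eventually_elim, simp)

section \<open>Finite spans of functions and best approximation\<close>

text \<open>The family \<open>b\<close> may be linearly dependent, so an induction on
  \<open>I\<close> can add one generator at a time without distinguishing cases.\<close>

definition function_span :: "('i \<Rightarrow> 'a \<Rightarrow> real) \<Rightarrow> 'i set \<Rightarrow> ('a \<Rightarrow> real) set" where
  "function_span b I = range (\<lambda>c x. \<Sum>i\<in>I. c i * b i x)"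

lemma function_span_add:
  assumes "g \<in> function_span b I" "h \<in> function_span b I"
  shows "(\<lambda>x. g x + h x) \<in> function_span b I"
proof -
  obtain c e where "g = (\<lambda>x. \<Sum>i\<in>I. c i * b i x)" "h = (\<lambda>x. \<Sum>i\<in>I. e i * b i x)"
    using assms by (auto simp: function_span_def)
  then show ?thesis
    unfolding function_span_def
    by (intro image_eqI[of _ _ "\<lambda>i. c i + e i"]) (simp_all add: sum.distrib distrib_right)
qed

lemma function_span_cmul:
  assumes "g \<in> function_span b I"
  shows "(\<lambda>x. a * g x) \<in> function_span b I"
proof -
  obtain c where "g = (\<lambda>x. \<Sum>i\<in>I. c i * b i x)"
    using assms by (auto simp: function_span_def)
  then show ?thesis
    unfolding function_span_def
    by (intro image_eqI[of _ _ "\<lambda>i. a * c i"]) (simp_all add: sum_distrib_left mult.assoc)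
qed

lemma function_span_diff:
  assumes "g \<in> function_span b I" "h \<in> function_span b I"
  shows "(\<lambda>x. g x - h x) \<in> function_span b I"
  using function_span_add[OF assms(1) function_span_cmul[OF assms(2), of "-1"]] by simp

lemma function_span_insert:
  assumes "finite I" "i \<notin> I"
  shows "h \<in> function_span b (insert i I) \<longleftrightarrow> (\<exists>t. \<exists>g\<in>function_span b I. h = (\<lambda>x. g x + t * b i x))"
proof
  assume "h \<in> function_span b (insert i I)"
  then obtain c where "h = (\<lambda>x. \<Sum>j\<in>insert i I. c j * b j x)"
    by (auto simp: function_span_def)
  then have "h = (\<lambda>x. (\<Sum>j\<in>I. c j * b j x) + c i * b i x)"
    using assms by (simp add: add.commute)
  then show "\<exists>t. \<exists>g\<in>function_span b I. h = (\<lambda>x. g x + t * b i x)"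
    by (auto simp: function_span_def)
next
  assume "\<exists>t. \<exists>g\<in>function_span b I. h = (\<lambda>x. g x + t * b i x)"
  then obtain t c where h: "h = (\<lambda>x. (\<Sum>j\<in>I. c j * b j x) + t * b i x)"
    by (auto simp: function_span_def)
  have "(\<Sum>j\<in>I. (if j = i then t else c j) * b j x) = (\<Sum>j\<in>I. c j * b j x)" for x
    using assms(2) by (intro sum.cong) auto
  then have "h = (\<lambda>x. \<Sum>j\<in>insert i I. (if j = i then t else c j) * b j x)"
    using assms by (simp add: h add.commute)
  then show "h \<in> function_span b (insert i I)"
    unfolding function_span_def
    by (rule range_eqI[where x = "\<lambda>j. if j = i then t else c j"])
qed

lemma function_span_L2:
  assumes "\<And>i. i \<in> I \<Longrightarrow> b i \<in> L2_functions S" "g \<in> function_span b I"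
  shows "g \<in> L2_functions S"
  using assms by (auto simp: function_span_def intro!: L2_functions_sum L2_functions_cmul)

text \<open>Gram-Schmidt by induction: \<open>r\<close> is the new generator minus its projection
  onto the old span, and the old projection \<open>g\<close> is corrected by the component of the
  error \<open>u\<close> along \<open>r\<close>.\<close>

lemma L2_projection_exists:
  assumes "finite I" "\<And>i. i \<in> I \<Longrightarrow> b i \<in> L2_functions S" "f \<in> L2_functions S"
  shows "\<exists>g\<in>function_span b I. \<forall>h\<in>function_span b I. L2_inner S (\<lambda>x. f x - g x) h = 0"
  using assms
proof (induction I arbitrary: f rule: finite_induct)
  case empty
  then show ?case by (auto simp: function_span_def L2_inner_def)
next
  case (insert i I)
  have L2: "g \<in> L2_functions S" if "g \<in> function_span b I" for g
    using function_span_L2[of I b S g] insert.prems(1) that by blast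
  have bi: "b i \<in> L2_functions S" using insert.prems by simp
  have IH: "\<exists>g\<in>function_span b I. \<forall>h\<in>function_span b I. L2_inner S (\<lambda>x. f' x - g x) h = 0"
    if "f' \<in> L2_functions S" for f'
    by (rule insert.IH[OF _ that]) (use insert.prems(1) in simp)
  obtain g where g: "g \<in> function_span b I"
    "\<And>h. h \<in> function_span b I \<Longrightarrow> L2_inner S (\<lambda>x. f x - g x) h = 0"
    using IH[OF insert.prems(2)] by blast
  obtain k where k: "k \<in> function_span b I"
    "\<And>h. h \<in> function_span b I \<Longrightarrow> L2_inner S (\<lambda>x. b i x - k x) h = 0"
    using IH[OF bi] by blast
  define r where "r = (\<lambda>x. b i x - k x)"
  define u where "u = (\<lambda>x. f x - g x)"
  have rL: "r \<in> L2_functions S" and uL: "u \<in> L2_functions S"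
    unfolding r_def u_def using L2 g(1) k(1) bi insert.prems(2) by (auto intro: L2_functions_diff)
  define t where "t = L2_inner S u r / L2_inner S r r"
  \<comment> \<open>If \<open>r\<close> vanishes almost everywhere, then \<open>t = 0\<close> because division by zero gives zero.\<close>
  have t: "L2_inner S u r - t * L2_inner S r r = 0"
    using L2_inner_eq_0[OF rL, of u] by (simp add: t_def L2_inner_commute[of S u r])
  define G where "G = (\<lambda>x. g x + t * r x)"
  have "G = (\<lambda>x. (g x - t * k x) + t * b i x)"
    by (simp add: G_def r_def algebra_simps fun_eq_iff)
  moreover have "(\<lambda>x. g x - t * k x) \<in> function_span b I"
    by (intro function_span_diff function_span_cmul g(1) k(1))
  ultimately have "G \<in> function_span b (insert i I)"
    unfolding function_span_insert[OF insert.hyps]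
    by (intro exI[of _ t] bexI[of _ "\<lambda>x. g x - t * k x"])
  moreover have "L2_inner S (\<lambda>x. f x - G x) h = 0" if "h \<in> function_span b (insert i I)" for h
  proof -
    from that obtain s where "\<exists>l\<in>function_span b I. h = (\<lambda>x. l x + s * b i x)"
      unfolding function_span_insert[OF insert.hyps] ..
    then obtain l where l: "l \<in> function_span b I" and h: "h = (\<lambda>x. l x + s * b i x)" ..
    \<comment> \<open>Trading \<open>b i\<close> for \<open>r\<close> splits \<open>h\<close> into a
      part in the old span and a multiple of \<open>r\<close>; the new error is orthogonal to
      both.\<close>
    define m where "m = (\<lambda>x. l x + s * k x)"
    have m: "m \<in> function_span b I"
      unfolding m_def by (intro function_span_add function_span_cmul l k(1))
    have h': "h = (\<lambda>x. m x + s * r x)"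
      by (simp add: h m_def r_def algebra_simps)
    have mL: "m \<in> L2_functions S" by (rule L2[OF m])
    define v where "v = (\<lambda>x. u x - t * r x)"
    have v: "v \<in> L2_functions S"
      unfolding v_def by (intro L2_functions_diff L2_functions_cmul rL uL)
    have v_inner: "L2_inner S v y = L2_inner S u y - t * L2_inner S r y" if "y \<in> L2_functions S" for y
      unfolding v_def using that rL uL
      by (simp add: L2_inner_diff_left L2_functions_cmul L2_inner_cmul_left)
    have "L2_inner S v m = 0" "L2_inner S v r = 0"
      using v_inner[OF mL] v_inner[OF rL] t g(2)[OF m] k(2)[OF m]
      by (simp_all add: u_def r_def)
    moreover have "L2_inner S v h = L2_inner S v m + s * L2_inner S v r"
      unfolding L2_inner_commute[of S v] h'
      using mL rL v by (simp add: L2_inner_add_left L2_functions_cmul L2_inner_cmul_left)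
    moreover have "(\<lambda>x. f x - G x) = v"
      by (simp add: G_def v_def u_def algebra_simps fun_eq_iff)
    ultimately show ?thesis by simp
  qed
  ultimately show ?case by blast
qed

text \<open>The difference of two candidates lies in \<open>V\<close> and is orthogonal to itself.
  \<open>definite\<close> turns its zero norm into equality as functions, which the definite
  description requires.\<close>

lemma L2_projection_spec:
  assumes V: "V = function_span b I" "finite I" "\<And>i. i \<in> I \<Longrightarrow> b i \<in> L2_functions S"
    and definite: "\<And>v. v \<in> V \<Longrightarrow> L2_inner S v v = 0 \<Longrightarrow> v = (\<lambda>x. 0)"
    and f: "f \<in> L2_functions S"
  shows "L2_projection S V f = g \<longleftrightarrow> g \<in> V \<and> (\<forall>v\<in>V. L2_inner S (\<lambda>x. f x - g x) v = 0)"
proof -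
  have L2: "v \<in> L2_functions S" if "v \<in> V" for v
    using function_span_L2[of I b S v] V(3) that unfolding V(1) by blast
  have "\<exists>!g. g \<in> V \<and> (\<forall>v\<in>V. L2_inner S (\<lambda>x. f x - g x) v = 0)"
  proof (rule ex_ex1I)
    show "\<exists>g. g \<in> V \<and> (\<forall>v\<in>V. L2_inner S (\<lambda>x. f x - g x) v = 0)"
      using L2_projection_exists[of I b S f, OF V(2,3) f] unfolding V(1) by blast
  next
    fix g h
    assume g: "g \<in> V \<and> (\<forall>v\<in>V. L2_inner S (\<lambda>x. f x - g x) v = 0)"
      and h: "h \<in> V \<and> (\<forall>v\<in>V. L2_inner S (\<lambda>x. f x - h x) v = 0)"
    define d where "d = (\<lambda>x. g x - h x)"
    have d: "d \<in> V" unfolding d_def using g h V(1) function_span_diff by blast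
    have L: "(\<lambda>x. f x - g x) \<in> L2_functions S" "(\<lambda>x. f x - h x) \<in> L2_functions S"
      using f g h L2 by (auto intro: L2_functions_diff)
    have "L2_inner S d d = L2_inner S (\<lambda>x. (f x - h x) - (f x - g x)) d"
      by (simp add: d_def)
    also have "\<dots> = L2_inner S (\<lambda>x. f x - h x) d - L2_inner S (\<lambda>x. f x - g x) d"
      by (rule L2_inner_diff_left[OF L(2,1) L2[OF d]])
    finally have "d = (\<lambda>x. 0)"
      using g h d by (intro definite) auto
    then show "g = h" by (auto simp: d_def fun_eq_iff)
  qed
  then show ?thesis
    unfolding L2_projection_def restrict_apply'[OF f]
    by (subst theI_unique[of "\<lambda>g. g \<in> V \<and> (\<forall>v\<in>V. L2_inner S (\<lambda>x. f x - g x) v = 0)"])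
       (assumption, rule eq_commute)
qed

section \<open>The patch\<close>

lemma sum_indicator_disjoint:
  fixes F :: "'a set \<Rightarrow> real"
  assumes "finite \<omega>" "disjoint \<omega>" "T0 \<in> \<omega>" "x \<in> T0"
  shows "(\<Sum>T\<in>\<omega>. indicator T x * F T) = F T0"
proof -
  have "(\<Sum>T\<in>\<omega>. indicator T x * F T) = (\<Sum>T\<in>{T0}. indicator T x * F T)"
    using assms by (intro sum.mono_neutral_right) (auto simp: indicator_def disjoint_def)
  then show ?thesis using assms(4) by simp
qed

text \<open>The generators are the monomials cut off to single elements. As the elements are
  disjoint, at each point at most one element contributes.\<close>

lemma piecewise_polys_eq_function_span:
  fixes \<omega> :: "(real^'d) set set"
  assumes "finite \<omega>" "disjoint \<omega>"
  shows "piecewise_polys p \<omega> = function_span (\<lambda>(T, \<alpha>) x. indicator T x * monomial \<alpha> x) (\<omega> \<times> multi_indices p)"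
proof -
  have sum_eq: "(\<Sum>i\<in>\<omega> \<times> multi_indices p. c i * (case i of (T, \<alpha>) \<Rightarrow> \<lambda>x. indicator T x * monomial \<alpha> x) x)
      = (\<Sum>T\<in>\<omega>. indicator T x * (\<Sum>\<alpha>\<in>multi_indices p. c (T, \<alpha>) * monomial \<alpha> x))" for c and x :: "real^'d"
    unfolding sum_distrib_left sum.cartesian_product by (intro sum.cong) (auto simp: mult_ac)
  note sum_on = sum_indicator_disjoint[OF assms]
  have sum_off: "(\<Sum>T\<in>\<omega>. indicator T x * F T) = 0" if "x \<notin> \<Union>\<omega>"
    for F :: "(real^'d) set \<Rightarrow> real" and x
    using that by (intro sum.neutral) (auto simp: indicator_def)
  show ?thesis
  proof (intro equalityI subsetI)
    fix v assume v: "v \<in> piecewise_polys p \<omega>"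
    then have "\<forall>T\<in>\<omega>. \<exists>c. \<forall>x\<in>T. v x = (\<Sum>\<alpha>\<in>multi_indices p. c \<alpha> * monomial \<alpha> x)"
      unfolding piecewise_polys_def polynomial_deg_le_iff by blast
    then obtain c where c: "\<And>T x. T \<in> \<omega> \<Longrightarrow> x \<in> T \<Longrightarrow> v x = (\<Sum>\<alpha>\<in>multi_indices p. c T \<alpha> * monomial \<alpha> x)"
      using bchoice[of \<omega> "\<lambda>T c. \<forall>x\<in>T. v x = (\<Sum>\<alpha>\<in>multi_indices p. c \<alpha> * monomial \<alpha> x)"] by blast
    have "v x = (\<Sum>T\<in>\<omega>. indicator T x * (\<Sum>\<alpha>\<in>multi_indices p. (\<lambda>(T, \<alpha>). c T \<alpha>) (T, \<alpha>) * monomial \<alpha> x))" for x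
    proof (cases "x \<in> \<Union>\<omega>")
      case True
      then obtain T where T: "T \<in> \<omega>" "x \<in> T" by blast
      show ?thesis unfolding sum_on[OF T] using c[OF T] by simp
    next
      case False
      then show ?thesis unfolding sum_off[OF False] using v by (simp add: piecewise_polys_def)
    qed
    then show "v \<in> function_span (\<lambda>(T, \<alpha>) x. indicator T x * monomial \<alpha> x) (\<omega> \<times> multi_indices p)"
      unfolding function_span_def sum_eq by (intro range_eqI[where x = "\<lambda>(T, \<alpha>). c T \<alpha>"] ext)
  next
    fix v assume "v \<in> function_span (\<lambda>(T, \<alpha>) x. indicator T x * monomial \<alpha> x) (\<omega> \<times> multi_indices p)"
    then obtain c where v: "v = (\<lambda>x. \<Sum>T\<in>\<omega>. indicator T x * (\<Sum>\<alpha>\<in>multi_indices p. c (T, \<alpha>) * monomial \<alpha> x))"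
      unfolding function_span_def sum_eq by blast
    have "\<exists>f. polynomial_deg_le p f \<and> (\<forall>x\<in>T. v x = f x)" if "T \<in> \<omega>" for T
      by (intro exI[of _ "\<lambda>x. \<Sum>\<alpha>\<in>multi_indices p. c (T, \<alpha>) * monomial \<alpha> x"] conjI
          polynomial_deg_le_sum polynomial_deg_le_cmul polynomial_deg_le_monomial)
         (use that in \<open>auto simp: v sum_on\<close>)
    then show "v \<in> piecewise_polys p \<omega>"
      by (auto simp: piecewise_polys_def v sum_off)
  qed
qed

lemma indicator_poly_piecewise:
  assumes "disjoint \<omega>" "T \<in> \<omega>" "polynomial_deg_le p f"
  shows "(\<lambda>x. indicator T x * f x) \<in> piecewise_polys p \<omega>"
proof -
  have "\<exists>g. polynomial_deg_le p g \<and> (\<forall>x\<in>T'. indicator T x * f x = g x)" if "T' \<in> \<omega>" for T'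
  proof (cases "T' = T")
    case True
    then show ?thesis using assms(3) by (intro exI[of _ f]) auto
  next
    case False
    then have "T' \<inter> T = {}" using assms(1,2) that by (auto simp: disjoint_def)
    then show ?thesis by (intro exI[of _ "\<lambda>x. 0"]) (auto simp: polynomial_deg_le_zero indicator_def)
  qed
  then show ?thesis
    using assms(2) by (auto simp: piecewise_polys_def indicator_def)
qed

text \<open>Boundaries of convex sets are negligible. Off them the hat function is, near the point,
  either affine or identically zero, so it can be differentiated there.\<close>

lemma AE_open_elements_or_outside:
  fixes \<omega> :: "'a::euclidean_space set set"
  assumes "finite \<omega>" "\<And>T. T \<in> \<omega> \<Longrightarrow> open T \<and> convex T"
  shows "AE x in lborel. x \<in> \<Union>\<omega> \<or> x \<notin> (\<Union>T\<in>\<omega>. closure T)"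
proof -
  have "negligible (\<Union>T\<in>\<omega>. frontier T)"
    using assms by (intro negligible_Union) (auto simp: negligible_convex_frontier)
  then have "AE x in lebesgue. x \<notin> (\<Union>T\<in>\<omega>. frontier T)"
    by (intro AE_not_in) (simp add: negligible_iff_null_sets)
  then have "AE x in lborel. x \<notin> (\<Union>T\<in>\<omega>. frontier T)"
    by (simp add: AE_completion_iff)
  then show ?thesis
  proof eventually_elim
    case (elim x)
    then show ?case
      using assms(2) by (auto simp: frontier_def interior_open)
  qed
qed

text \<open>Testing \<open>f\<close> against \<open>v = \<Sum>i. \<partial>\<^sub>i (hat \<cdot> \<partial>\<^sub>i f)\<close>, one direction at a time.\<close>

lemma orthogonal_imp_zero_on_elements:
  fixes \<omega> :: "(real^'d) set set"
  assumes star: "simplicial_star (closure ` \<omega>) z \<mu>"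
    and fin: "finite \<omega>" and disj: "disjoint \<omega>"
    and elem: "\<And>T. T \<in> \<omega> \<Longrightarrow> open T \<and> convex T"
    and f: "polynomial_deg_le (p + 1) f"
    and orth: "\<And>v. v \<in> piecewise_polys p \<omega> \<Longrightarrow> (\<integral>x. f x * v x \<partial>lborel) = 0"
    and T: "T \<in> \<omega>" "x \<in> T"
  shows "f x = 0"
proof -
  interpret simplicial_star "closure ` \<omega>" z \<mu> by (rule star)
  have bounded_elem: "bounded T" if "T \<in> \<omega>" for T
  proof (rule bounded_subset[OF _ closure_subset])
    show "bounded (closure T)"
      using that star_convex_compact(2)[of "closure T"] by (simp add: compact_imp_bounded)
  qed
  obtain D where D: "\<And>i. polynomial_deg_le p (D i)"
    "\<And>x. (f has_derivative (\<lambda>h. \<Sum>i\<in>UNIV. h $ i * D i x)) (at x)"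
    using polynomial_deg_le_has_derivative[OF f] by auto
  have "\<forall>i. \<exists>E. (\<forall>j. polynomial_deg_le (p - 1) (E j) \<and> (p = 0 \<longrightarrow> E j = (\<lambda>x. 0))) \<and>
      (\<forall>x. (D i has_derivative (\<lambda>h. \<Sum>j\<in>UNIV. h $ j * E j x)) (at x))"
    using polynomial_deg_le_has_derivative[OF D(1)] by blast
  from choice[OF this] obtain E where
    E: "\<And>i j. polynomial_deg_le (p - 1) (E i j)" "\<And>i j. p = 0 \<Longrightarrow> E i j = (\<lambda>x. 0)"
    "\<And>i x. (D i has_derivative (\<lambda>h. \<Sum>j\<in>UNIV. h $ j * E i j x)) (at x)"
    by blast
  have \<mu>_poly: "polynomial_deg_le 1 (\<lambda>x. 1 - \<mu> (closure T) (x - z))" if "T \<in> \<omega>" for T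
  proof -
    have lin: "linear (\<mu> (closure T))" using that by (intro linear_\<mu>) simp
    have "polynomial_deg_le 1 (\<lambda>x. (1 + \<mu> (closure T) z) - \<mu> (closure T) x)"
      by (intro polynomial_deg_le_diff polynomial_deg_le_const polynomial_deg_le_linear lin)
    then show ?thesis by (simp add: linear_diff[OF lin] algebra_simps)
  qed
  have elem_borel: "T \<in> sets borel" if "T \<in> \<omega>" for T
    using elem[OF that] by (simp add: borel_open)
  \<comment> \<open>This is \<open>\<partial>_i (hat * D i)\<close> on \<open>T\<close>, where the
    hat function has the constant derivative \<open>- \<mu> (closure T) (axis i 1)\<close>.\<close>
  define V where "V i T x = - \<mu> (closure T) (axis i 1) * D i x + (1 - \<mu> (closure T) (x - z)) * E i i x"
    for i T x
  have V: "polynomial_deg_le p (V i T)" if "T \<in> \<omega>" for i T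
  proof -
    have "polynomial_deg_le p (\<lambda>x. (1 - \<mu> (closure T) (x - z)) * E i i x)"
    \<comment> \<open>For \<open>p = 0\<close> the truncated \<open>p - 1\<close> would allow degree
      1; here the second derivatives vanish instead.\<close>
    proof (cases "p = 0")
      case True
      then show ?thesis using E(2) by (simp add: polynomial_deg_le_zero)
    next
      case False
      then show ?thesis
        using polynomial_deg_le_mult[OF \<mu>_poly[OF that] E(1)[of i i]] by simp
    qed
    then show ?thesis
      unfolding V_def by (intro polynomial_deg_le_add polynomial_deg_le_cmul D(1))
  qed
  have zero: "D i y = 0" if y: "T \<in> \<omega>" "y \<in> T" for i T y
  proof -
    define e where "e = (axis i 1 :: real^'d)"
    define g where "g x = f x * D i x" for x
    have g: "polynomial_deg_le (p + 1 + p) g"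
      unfolding g_def by (rule polynomial_deg_le_mult[OF f D(1)])
    obtain L where L: "L-lipschitz_on UNIV hat" by (rule hat_lipschitz)
    obtain R where R: "(\<Union>T\<in>\<omega>. closure T) \<subseteq> cball z R"
    proof -
      have "bounded (\<Union>T\<in>\<omega>. closure T)"
        using fin bounded_elem by (intro bounded_UN) (auto intro: bounded_closure)
      then obtain r where "(\<Union>T\<in>\<omega>. closure T) \<subseteq> ball z r"
        using bounded_subset_ballD by blast
      then show thesis using ball_subset_cball by (intro that[of r]) (rule subset_trans)
    qed
    have hat0: "hat x = 0" if "x \<notin> cball z R" for x
      using that R by (intro hat_outside) auto
    obtain M where M: "M-lipschitz_on (cball z (R + 2 * norm e)) g"
      by (rule polynomial_deg_le_lipschitz_cball[OF g])
    have gc: "continuous_on UNIV g" by (rule polynomial_deg_le_continuous_on[OF g])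
    note lip = lipschitz_mult_compact_support[OF L hat0 M gc]
    obtain w where w: "integrable lborel w"
      "\<And>x h. 0 < h \<Longrightarrow> h \<le> 1 \<Longrightarrow> \<bar>hat (x + h *\<^sub>R e) * g (x + h *\<^sub>R e) - hat x * g x\<bar> \<le> h * w x"
      using lip(2) by blast
    define v where "v x = (\<Sum>T\<in>\<omega>. indicator T x * V i T x)" for x
    define Q where "Q x = (\<Sum>T\<in>\<omega>. indicator T x * (hat x * (D i x)\<^sup>2))" for x
    have hatc: "continuous_on UNIV hat" by (rule lipschitz_on_continuous_on[OF L])
    have fv: "integrable lborel (\<lambda>x. f x * v x)"
    proof -
      have "integrable lborel (\<lambda>x. \<Sum>T\<in>\<omega>. indicator T x * (f x * V i T x))"
        by (intro Bochner_Integration.integrable_sum integrable_lborel_indicator_continuous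
            continuous_on_mult elem_borel bounded_elem polynomial_deg_le_continuous_on[OF f]
            polynomial_deg_le_continuous_on[OF V])
      moreover have "(\<lambda>x. \<Sum>T\<in>\<omega>. indicator T x * (f x * V i T x)) = (\<lambda>x. f x * v x)"
        by (simp add: v_def sum_distrib_left mult_ac)
      ultimately show ?thesis by simp
    qed
    have Qi: "integrable lborel Q"
      unfolding Q_def
      by (intro Bochner_Integration.integrable_sum integrable_lborel_indicator_continuous
          continuous_on_mult continuous_on_power elem_borel bounded_elem hatc
          polynomial_deg_le_continuous_on[OF D(1)])
    have vP: "v \<in> piecewise_polys p \<omega>"
      unfolding piecewise_polys_def
    proof (intro CollectI conjI ballI allI impI)
      show "\<exists>f. polynomial_deg_le p f \<and> (\<forall>x\<in>T. v x = f x)" if "T \<in> \<omega>" for T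
        using V[OF that] sum_indicator_disjoint[OF fin disj that] by (auto simp: v_def)
      show "v x = 0" if "x \<notin> \<Union>\<omega>" for x
        unfolding v_def using that by (intro sum.neutral) (auto simp: indicator_def)
    qed
    have ae: "AE x in lborel. x \<in> \<Union>\<omega> \<or> x \<notin> (\<Union>T\<in>\<omega>. closure T)"
      by (rule AE_open_elements_or_outside[OF fin]) (rule elem)
    \<comment> \<open>The product rule grouped as \<open>\<partial>_i (hat * f * D i) = f *
      \<partial>_i (hat * D i) + hat * (D i)^2\<close>: the first term is removed by orthogonality,
      the second is nonnegative.\<close>
    have deriv: "AE x in lborel. ((\<lambda>t. hat (x + t *\<^sub>R e) * g (x + t *\<^sub>R e)) has_real_derivative
        f x * v x + Q x) (at 0)"
      using ae
    proof eventually_elim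
      case (elim x)
      have cont: "continuous_on UNIV (\<lambda>t. x + t *\<^sub>R e)" by (intro continuous_intros)
      show ?case
      proof (cases "x \<in> \<Union>\<omega>")
        case True
        then obtain T where T: "T \<in> \<omega>" "x \<in> T" by blast
        have lin: "linear (\<mu> (closure T))" using T by (intro linear_\<mu>) simp
        have hatT: "hat y = 1 - \<mu> (closure T) (y - z)" if "y \<in> T" for y
          using T that closure_subset by (intro hat_eq) auto
        \<comment> \<open>For small \<open>t\<close> the line stays in the open element
          \<open>T\<close>, so the hat function may be replaced by its affine formula.\<close>
        have "((\<lambda>t. 1 - \<mu> (closure T) (x - z) - t * \<mu> (closure T) e) has_real_derivative
            - \<mu> (closure T) e) (at 0)"
          by (auto intro!: derivative_eq_intros)
        then have "((\<lambda>t. hat (x + t *\<^sub>R e)) has_real_derivative - \<mu> (closure T) e) (at 0)"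
        proof (rule has_field_derivative_transform_within_open)
          show "open ((\<lambda>t. x + t *\<^sub>R e) -` T)"
            using elem[OF T(1)] cont by (simp add: open_vimage)
          show "1 - \<mu> (closure T) (x - z) - t * \<mu> (closure T) e = hat (x + t *\<^sub>R e)"
            if "t \<in> (\<lambda>t. x + t *\<^sub>R e) -` T" for t
            using that by (simp add: hatT linear_diff[OF lin] linear_add[OF lin] linear_cmul[OF lin])
        qed (use T in simp)
        moreover have "((\<lambda>t. f (x + t *\<^sub>R e)) has_real_derivative D i x) (at 0)"
          unfolding e_def by (rule polynomial_deg_le_partial[OF D(2)])
        moreover have "((\<lambda>t. D i (x + t *\<^sub>R e)) has_real_derivative E i i x) (at 0)"
          unfolding e_def by (rule polynomial_deg_le_partial[OF E(3)])
        ultimately have "((\<lambda>t. hat (x + t *\<^sub>R e) * (f (x + t *\<^sub>R e) * D i (x + t *\<^sub>R e))) has_real_derivative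
            - \<mu> (closure T) e * (f (x + 0 *\<^sub>R e) * D i (x + 0 *\<^sub>R e))
            + (D i x * D i (x + 0 *\<^sub>R e) + E i i x * f (x + 0 *\<^sub>R e)) * hat (x + 0 *\<^sub>R e)) (at 0)"
          by (intro DERIV_mult)
        moreover have "- \<mu> (closure T) e * (f (x + 0 *\<^sub>R e) * D i (x + 0 *\<^sub>R e))
            + (D i x * D i (x + 0 *\<^sub>R e) + E i i x * f (x + 0 *\<^sub>R e)) * hat (x + 0 *\<^sub>R e) = f x * v x + Q x"
        proof -
          have "v x = - \<mu> (closure T) e * D i x + hat x * E i i x" "Q x = hat x * (D i x)\<^sup>2"
            using sum_indicator_disjoint[OF fin disj T, of "\<lambda>T. V i T x"]
              sum_indicator_disjoint[OF fin disj T, of "\<lambda>_. hat x * (D i x)\<^sup>2"] hatT[OF T(2)]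
            unfolding v_def Q_def V_def e_def by simp_all
          note vQ = this
          show ?thesis unfolding vQ by (simp add: algebra_simps power2_eq_square)
        qed
        ultimately show ?thesis unfolding g_def by (simp only:)
      next
        case False
        then have out: "x \<notin> (\<Union>T\<in>\<omega>. closure T)" using elim by simp
        have "((\<lambda>t. 0) has_real_derivative 0) (at 0)" by simp
        then have "((\<lambda>t. hat (x + t *\<^sub>R e) * g (x + t *\<^sub>R e)) has_real_derivative 0) (at 0)"
        proof (rule has_field_derivative_transform_within_open)
          have "closed (\<Union>T\<in>\<omega>. closure T)" using fin by (intro closed_UN) auto
          then show "open ((\<lambda>t. x + t *\<^sub>R e) -` (- (\<Union>T\<in>\<omega>. closure T)))"
            by (rule open_vimage[OF open_Compl cont])
          show "0 = hat (x + t *\<^sub>R e) * g (x + t *\<^sub>R e)"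
            if "t \<in> (\<lambda>t. x + t *\<^sub>R e) -` (- (\<Union>T\<in>\<omega>. closure T))" for t
            using that by (subst hat_outside) auto
        qed (use out in simp)
        moreover have "v x = 0" "Q x = 0"
          unfolding v_def Q_def using False by (auto intro!: sum.neutral simp: indicator_def)
        ultimately show ?thesis by simp
      qed
    qed
    have "(\<integral>x. f x * v x + Q x \<partial>lborel) = 0"
    proof (rule integral_directional_derivative_eq_0(2)[OF lip(1) _ w(1) _ deriv])
      show "(\<lambda>x. f x * v x + Q x) \<in> borel_measurable borel"
        using borel_measurable_integrable[OF Bochner_Integration.integrable_add[OF fv Qi]] by simp
    qed (assumption, rule w(2))
    then have "integral\<^sup>L lborel Q = 0"
      using fv Qi orth[OF vP] by simp
    moreover have "AE x in lborel. 0 \<le> Q x"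
      unfolding Q_def by (intro always_eventually allI sum_nonneg) (auto simp: hat_def)
    ultimately have "AE x in lborel. Q x = 0"
      using integral_nonneg_eq_0_iff_AE[OF Qi] by simp
    then have ae0: "AE x in lborel. x \<in> T \<longrightarrow> hat x * (D i x)\<^sup>2 = 0"
    proof eventually_elim
      case (elim x)
      have "Q x = hat x * (D i x)\<^sup>2" if "x \<in> T"
        unfolding Q_def by (rule sum_indicator_disjoint[OF fin disj y(1) that])
      with elim show ?case by auto
    qed
    have "continuous_on T (\<lambda>x. hat x * (D i x)\<^sup>2)"
      by (intro continuous_on_mult continuous_on_power continuous_on_subset[OF hatc]
          polynomial_deg_le_continuous_on[OF D(1)]) simp
    then have "hat y * (D i y)\<^sup>2 = 0"
      using elem[OF y(1)] by (intro continuous_AE_zero_imp_zero[OF _ _ ae0 y(2)]) simp_all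
    moreover have "hat y > 0"
    proof (rule hat_pos[of "closure T"])
      show "y \<in> interior (closure T)"
        using y elem[OF y(1)] interior_maximal[OF closure_subset, of T] by blast
    qed (use y in simp)
    ultimately show ?thesis by simp
  qed
  have "\<exists>c. \<forall>y\<in>T. f y = c"
  proof (rule has_derivative_zero_constant)
    show "(f has_derivative (\<lambda>h. 0)) (at y within T)" if "y \<in> T" for y
      using has_derivative_at_withinI[OF D(2), of y T] zero[OF T(1) that] by simp
  qed (use elem[OF T(1)] in simp)
  then obtain c where c: "\<And>y. y \<in> T \<Longrightarrow> f y = c" by blast
  \<comment> \<open>The test function is \<open>f\<close> itself cut off to \<open>T\<close>, so the
    pairing is \<open>c^2\<close> times the measure of \<open>T\<close>.\<close>
  have "(\<lambda>y. indicator T y * c) \<in> piecewise_polys p \<omega>"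
    by (rule indicator_poly_piecewise[OF disj T(1) polynomial_deg_le_const])
  then have "(\<integral>y. f y * (indicator T y * c) \<partial>lborel) = 0" by (rule orth)
  moreover have "f y * (indicator T y * c) = indicator T y * c\<^sup>2" for y
    using c by (auto simp: indicator_def power2_eq_square)
  ultimately have "(\<integral>y. indicator T y * c\<^sup>2 \<partial>lborel) = 0" by simp
  moreover have "integrable lborel (\<lambda>y. indicator T y * c\<^sup>2)"
    by (intro integrable_lborel_indicator_continuous elem_borel bounded_elem T(1)) simp
  ultimately have "AE y in lborel. indicator T y * c\<^sup>2 = 0"
    using integral_nonneg_eq_0_iff_AE[of lborel "\<lambda>y. indicator T y * c\<^sup>2"] by simp
  then have "AE y in lborel. y \<in> T \<longrightarrow> c = 0"
    by eventually_elim (auto simp: indicator_def)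
  then have "c = 0"
    by (rule continuous_AE_zero_imp_zero[of T "\<lambda>_. c", OF _ continuous_on_const _ T(2), rotated])
       (use elem[OF T(1)] in simp)
  with c[OF T(2)] show ?thesis by simp
qed

section \<open>Passage to the Lebesgue inner product and to the mesh\<close>

lemma indicator_continuous_L2:
  fixes g :: "real^'d \<Rightarrow> real"
  assumes "T \<in> sets borel" "bounded T" "S \<in> sets borel" "continuous_on UNIV g"
  shows "(\<lambda>x. indicator T x * g x) \<in> L2_functions S"
proof -
  have [measurable]: "g \<in> borel_measurable borel" "T \<in> sets borel" "S \<in> sets borel"
    using assms by (auto intro: borel_measurable_continuous_onI)
  have "(\<lambda>x. indicator T x * g x) \<in> borel_measurable lborel" by measurable
  then have "(\<lambda>x. indicator T x * g x) \<in> borel_measurable (lebesgue_on S)"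
    by (intro measurable_restrict_space1 measurable_completion)
  moreover have "integrable (lebesgue_on S) (\<lambda>x. (indicator T x * g x)\<^sup>2)"
  proof -
    have "integrable lborel (\<lambda>x. indicator (S \<inter> T) x * (g x)\<^sup>2)"
      using assms by (intro integrable_lborel_indicator_continuous continuous_on_power) (auto intro: bounded_subset)
    moreover have "(\<lambda>x. indicator (S \<inter> T) x * (g x)\<^sup>2) = (\<lambda>x. indicator S x *\<^sub>R (indicator T x * g x)\<^sup>2)"
      by (auto simp: indicator_def)
    ultimately show ?thesis
      using assms(3) by (simp add: integrable_restrict_space integrable_completion)
  qed
  ultimately show ?thesis by (simp add: L2_functions_def)
qed

text \<open>For Borel data, completing the measure does not change the integral; the translation
  argument is carried out in \<open>lborel\<close>.\<close>

lemma L2_inner_eq_lborel: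
  fixes f g :: "real^'d \<Rightarrow> real"
  assumes "S \<in> sets borel" "f \<in> borel_measurable borel" "g \<in> borel_measurable borel"
  shows "L2_inner S f g = (\<integral>x. indicator S x * (f x * g x) \<partial>lborel)"
  unfolding L2_inner_def using assms
  by (simp add: integral_restrict_space integral_completion)

text \<open>The last identity recovers an element from its closure, as \<open>triangulation\<close>
  speaks of closed simplices only.\<close>

lemma open_simplex_props:
  fixes T :: "(real^'d) set"
  assumes "open_simplex T"
  shows "open T" "convex T" "interior (closure T) = T"
proof -
  obtain K where K: "int CARD('d) simplex K" "T = interior K"
    using assms by (auto simp: open_simplex_def)
  then have "convex K" by (auto simp: simplex_def)
  then show "convex T" using K(2) by simp
  show "open T" using K(2) by simp
  then show "interior (closure T) = T"
    using convex_interior_closure[OF \<open>convex T\<close>] by (simp add: interior_open)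
qed

lemma patch_star:
  fixes \<Omega> :: "(real^'d) set"
  assumes "open \<Omega>" and tri: "conforming_triangulation \<Omega> \<T>" and z: "z \<in> interior_vertices \<Omega> \<T>"
  shows "finite (patch \<T> z)" "disjoint (patch \<T> z)" "\<exists>\<mu>. simplicial_star (closure ` patch \<T> z) z \<mu>"
proof -
  have simplices: "open_simplex T" if "T \<in> \<T>" for T
    using tri that by (simp add: conforming_triangulation_def)
  note props = open_simplex_props[OF simplices]
  have inj: "inj_on closure \<T>"
    by (rule inj_on_inverseI[of _ interior]) (simp add: props)
  have tri': "finite (closure ` \<T>)" "\<And>T. T \<in> \<T> \<Longrightarrow> \<exists>n. n simplex closure T"
    "\<And>T T'. T \<in> \<T> \<Longrightarrow> T' \<in> \<T> \<Longrightarrow> closure T \<inter> closure T' face_of closure T"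
    using tri by (auto simp: conforming_triangulation_def triangulation_def)
  have fin: "finite \<T>" using finite_imageD[OF tri'(1) inj] .
  then show fin': "finite (patch \<T> z)" by (simp add: patch_def)
  \<comment> \<open>A proper face misses the relative interior, so elements that overlap have nested
    closures, and by symmetry equal ones.\<close>
  have eq: "closure T \<inter> closure T' = closure T" if "T \<in> \<T>" "T' \<in> \<T>" "T \<inter> T' \<noteq> {}" for T T'
  proof (rule ccontr)
    assume "closure T \<inter> closure T' \<noteq> closure T"
    then have "(closure T \<inter> closure T') \<inter> rel_interior (closure T) = {}"
      by (rule face_of_disjoint_rel_interior[OF tri'(3)[OF that(1,2)]])
    moreover have "T \<subseteq> rel_interior (closure T)"
      using interior_subset_rel_interior[of "closure T"] props(3)[OF that(1)] by simp
    ultimately show False using that(3) closure_subset[of T] closure_subset[of T'] by blast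
  qed
  show "disjoint (patch \<T> z)"
    unfolding disjoint_def
  proof (intro ballI impI)
    fix T T' assume TT': "T \<in> patch \<T> z" "T' \<in> patch \<T> z" "T \<noteq> T'"
    then show "T \<inter> T' = {}"
      using eq[of T T'] eq[of T' T] inj_onD[OF inj, of T T'] by (auto simp: patch_def Int_commute)
  qed
  obtain T0 where T0: "T0 \<in> \<T>" "z extreme_point_of closure T0" and "z \<in> \<Omega>"
    using z by (auto simp: interior_vertices_def)
  \<comment> \<open>By definition \<open>z\<close> is a vertex of one element only. It is then
    extreme in the common face with any other element of the patch, hence a vertex of that element
    too.\<close>
  have apex: "z extreme_point_of closure T" if "T \<in> patch \<T> z" for T
  proof -
    have T: "T \<in> \<T>" "z \<in> closure T" using that by (auto simp: patch_def)
    have "z \<in> closure T0" using T0(2) by (simp add: extreme_point_of_def)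
    then have "z extreme_point_of (closure T0 \<inter> closure T)"
      using extreme_point_of_face[OF tri'(3)[OF T0(1) T(1)]] T0(2) T(2) by simp
    then show ?thesis
      using extreme_point_of_face[OF tri'(3)[OF T(1) T0(1)]] by (simp add: Int_commute)
  qed
  \<comment> \<open>Removing from \<Omega> the finitely many closed elements that miss
    \<open>z\<close> leaves an open neighbourhood covered by the patch.\<close>
  have interior: "z \<in> interior (\<Union> (closure ` patch \<T> z))"
  proof (rule interiorI)
    show "open (\<Omega> - (\<Union>T\<in>\<T> - patch \<T> z. closure T))"
      using fin assms(1) by (intro open_Diff closed_UN) auto
    show "z \<in> \<Omega> - (\<Union>T\<in>\<T> - patch \<T> z. closure T)"
      using \<open>z \<in> \<Omega>\<close> by (auto simp: patch_def)
    have "\<Omega> \<subseteq> (\<Union>T\<in>\<T>. closure T)"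
      using tri closure_subset[of \<Omega>] by (simp add: conforming_triangulation_def)
    then show "\<Omega> - (\<Union>T\<in>\<T> - patch \<T> z. closure T) \<subseteq> \<Union> (closure ` patch \<T> z)" by blast
  qed
  have "\<forall>K\<in>closure ` patch \<T> z. \<exists>\<mu> :: real^'d \<Rightarrow> real. linear \<mu> \<and>
      (\<forall>v. v extreme_point_of K \<longrightarrow> v \<noteq> z \<longrightarrow> \<mu> (v - z) = 1)"
  proof
    fix K assume K: "K \<in> closure ` patch \<T> z"
    then obtain n where "n simplex K" using tri'(2) by (auto simp: patch_def)
    then obtain \<mu> :: "real^'d \<Rightarrow> real" where "linear \<mu>"
      "\<And>v. v extreme_point_of K \<Longrightarrow> v \<noteq> z \<Longrightarrow> \<mu> (v - z) = 1"
      using simplex_barycentric_functional[of n K z] apex K by blast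
    then show "\<exists>\<mu> :: real^'d \<Rightarrow> real. linear \<mu> \<and>
      (\<forall>v. v extreme_point_of K \<longrightarrow> v \<noteq> z \<longrightarrow> \<mu> (v - z) = 1)" by blast
  qed
  from bchoice[OF this] obtain \<mu> :: "(real^'d) set \<Rightarrow> real^'d \<Rightarrow> real" where
    \<mu>: "\<And>K. K \<in> closure ` patch \<T> z \<Longrightarrow> linear (\<mu> K)"
    "\<And>K v. K \<in> closure ` patch \<T> z \<Longrightarrow> v extreme_point_of K \<Longrightarrow> v \<noteq> z \<Longrightarrow> \<mu> K (v - z) = 1"
    by blast
  have "simplicial_star (closure ` patch \<T> z) z \<mu>"
  proof (rule simplicial_star.intro)
    show "K \<inter> K' face_of K" if "K \<in> closure ` patch \<T> z" "K' \<in> closure ` patch \<T> z" for K K'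
      using that tri'(3) by (auto simp: patch_def)
    show "\<exists>n. n simplex K" if "K \<in> closure ` patch \<T> z" for K
      using that tri'(2) by (auto simp: patch_def)
    show "finite (closure ` patch \<T> z)" using fin' by simp
    show "z extreme_point_of K" if "K \<in> closure ` patch \<T> z" for K
      using that apex by blast
  qed (fact interior \<mu>)+
  then show "\<exists>\<mu>. simplicial_star (closure ` patch \<T> z) z \<mu>" by (intro exI[of _ \<mu>])
qed

lemma admissible_domain_open: "admissible_domain \<Omega> \<Longrightarrow> open \<Omega>"
  by (auto simp: admissible_domain_def lipschitz_domain_def open_box)

text \<open>What remains is to pass between \<open>q\<close>, extended by zero outside the patch
  domain, and its polynomial \<open>f\<close>, which lives on the whole space and can be
  differentiated there.\<close>

theorem lemma3:
  fixes \<Omega> :: "(real^'d) set" and \<T> :: "(real^'d) set set" and z :: "real^'d" and p :: nat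
  assumes "admissible_domain \<Omega>"
    and "conforming_triangulation \<Omega> \<T>"
    and "z \<in> interior_vertices \<Omega> \<T>"
  shows "{q \<in> polys_on (p + 1) (patch_domain \<T> z). patch_projection \<T> z p q = (\<lambda>x. 0)} = {\<lambda>x. 0}"
proof -
  define \<omega> where "\<omega> = patch \<T> z"
  define S where "S = patch_domain \<T> z"
  define V where "V = piecewise_polys p \<omega>"
  define I where "I = \<omega> \<times> (multi_indices p :: ('d \<Rightarrow> nat) set)"
  define b :: "(real^'d) set \<times> ('d \<Rightarrow> nat) \<Rightarrow> real^'d \<Rightarrow> real"
    where "b = (\<lambda>(T, \<alpha>) x. indicator T x * monomial \<alpha> x)"
  have fin: "finite \<omega>" and disj: "disjoint \<omega>" and "\<exists>\<mu>. simplicial_star (closure ` \<omega>) z \<mu>"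
    using patch_star[OF admissible_domain_open assms(2,3)] assms(1) unfolding \<omega>_def by auto
  then obtain \<mu> where star: "simplicial_star (closure ` \<omega>) z \<mu>" by blast
  have elem: "open T \<and> convex T" if "T \<in> \<omega>" for T
    using that assms(2) open_simplex_props[of T]
    by (auto simp: \<omega>_def patch_def conforming_triangulation_def)
  have bounded_closure_elem: "bounded (closure T)" if "T \<in> \<omega>" for T
    using that simplicial_star.star_convex_compact(2)[OF star] compact_imp_bounded by blast
  have bounded_elem: "bounded T" if "T \<in> \<omega>" for T
    using bounded_closure_elem[OF that] closure_subset by (rule bounded_subset)
  have S: "open S" "bounded S" "\<And>T. T \<in> \<omega> \<Longrightarrow> T \<subseteq> S"
  proof -
    show "open S" by (simp add: S_def patch_domain_def)
    have "bounded (\<Union>T\<in>\<omega>. closure T)" using fin bounded_closure_elem by auto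
    then show "bounded S"
      using interior_subset bounded_subset unfolding S_def patch_domain_def \<omega>_def by metis
    show "T \<subseteq> S" if "T \<in> \<omega>" for T
      unfolding S_def patch_domain_def \<omega>_def[symmetric]
      using that elem closure_subset by (intro interior_maximal) auto
  qed
  have borel: "S \<in> sets borel" "\<And>T. T \<in> \<omega> \<Longrightarrow> T \<in> sets borel"
    using S(1) elem by (auto intro: borel_open)
  have mono_cont: "continuous_on UNIV (monomial \<alpha> :: real^'d \<Rightarrow> real)" for \<alpha>
    unfolding monomial_def by (intro continuous_intros)
  have bL2: "b i \<in> L2_functions S" if "i \<in> I" for i
    using that indicator_continuous_L2[OF borel(2) bounded_elem borel(1) mono_cont]
    unfolding b_def I_def by auto
  have span: "V = function_span b I"
    unfolding V_def b_def I_def by (rule piecewise_polys_eq_function_span[OF fin disj])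
  have finI: "finite I" using fin by (simp add: I_def finite_multi_indices)
  have VL2: "v \<in> L2_functions S" if "v \<in> V" for v
    using function_span_L2[of I b S v] bL2 that unfolding span by blast
  have V_borel: "v \<in> borel_measurable borel" if "v \<in> V" for v
  proof -
    have "(\<lambda>x. indicator T x * monomial \<alpha> x :: real) \<in> borel_measurable borel" if "T \<in> \<omega>" for T \<alpha>
      by (intro borel_measurable_times borel_measurable_indicator borel(2)[OF that]
          borel_measurable_continuous_onI[OF mono_cont])
    then have "b i \<in> borel_measurable borel" if "i \<in> I" for i
      using that unfolding b_def I_def by auto
    then show ?thesis
      using that unfolding span function_span_def
      by (auto intro!: borel_measurable_sum borel_measurable_times[OF borel_measurable_const])
  qed
  \<comment> \<open>Continuity gives zero on each open element; off the elements the chosen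
    representative is zero by definition.\<close>
  have definite: "v = (\<lambda>x. 0)" if v: "v \<in> V" "L2_inner S v v = 0" for v
  proof
    fix x
    have "AE x in lebesgue. x \<in> S \<longrightarrow> v x = 0"
      using L2_inner_self_eq_0[OF VL2[OF v(1)] v(2)] borel(1) by (simp add: AE_restrict_space_iff)
    then have ae: "AE x in lborel. x \<in> S \<longrightarrow> v x = 0" by (simp add: AE_completion_iff)
    show "v x = 0"
    proof (cases "x \<in> \<Union>\<omega>")
      case True
      then obtain T where T: "T \<in> \<omega>" "x \<in> T" by blast
      obtain f where f: "polynomial_deg_le p f" "\<And>y. y \<in> T \<Longrightarrow> v y = f y"
        using v(1) T(1) unfolding V_def piecewise_polys_def by blast
      have "AE x in lborel. x \<in> T \<longrightarrow> f x = 0"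
        using ae by eventually_elim (use S(3)[OF T(1)] f(2) in auto)
      then show ?thesis
        using continuous_AE_zero_imp_zero[of T f x] elem[OF T(1)] polynomial_deg_le_continuous_on[OF f(1)] T f(2)
        by simp
    qed (use v(1) in \<open>simp add: V_def piecewise_polys_def\<close>)
  qed
  have zeroV: "(\<lambda>x. 0) \<in> V"
    unfolding V_def piecewise_polys_def using polynomial_deg_le_zero by blast
  have qL2: "q \<in> L2_functions S" if f: "polynomial_deg_le k f" "q = (\<lambda>x. indicator S x * f x)" for k f q
    unfolding f(2) by (intro indicator_continuous_L2 borel S(2) polynomial_deg_le_continuous_on[OF f(1)])
  have kernel: "patch_projection \<T> z p q = (\<lambda>x. 0) \<longleftrightarrow> (\<forall>v\<in>V. L2_inner S q v = 0)"
    if "q \<in> L2_functions S" for q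
    using L2_projection_spec[OF span finI bL2 definite that, of "\<lambda>x. 0"] zeroV
    by (simp add: patch_projection_def S_def V_def \<omega>_def)
  show ?thesis
  proof (intro equalityI subsetI)
    fix q assume "q \<in> {q \<in> polys_on (p + 1) (patch_domain \<T> z). patch_projection \<T> z p q = (\<lambda>x. 0)}"
    then obtain f where f: "polynomial_deg_le (p + 1) f" "\<And>x. x \<in> S \<Longrightarrow> q x = f x"
      and q0: "\<And>x. x \<notin> S \<Longrightarrow> q x = 0" and proj: "patch_projection \<T> z p q = (\<lambda>x. 0)"
      unfolding polys_on_def S_def by blast
    have q: "q = (\<lambda>x. indicator S x * f x)"
      using f(2) q0 by (auto simp: indicator_def)
    have fb: "f \<in> borel_measurable borel" by (rule polynomial_deg_le_borel_measurable[OF f(1)])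
    then have qb: "q \<in> borel_measurable borel"
      unfolding q using borel(1) by (intro borel_measurable_times borel_measurable_indicator)
    have orth: "(\<integral>x. f x * v x \<partial>lborel) = 0" if "v \<in> piecewise_polys p \<omega>" for v
    proof -
      have v: "v \<in> V" using that by (simp add: V_def)
      \<comment> \<open>Test functions vanish outside \<open>S\<close>, so replacing
        \<open>q\<close> by the uncut polynomial does not change the pairing.\<close>
      have "v x = 0" if "x \<notin> S" for x
        using S(3) \<open>v \<in> piecewise_polys p \<omega>\<close> that unfolding piecewise_polys_def by blast
      then have "indicator S x * (q x * v x) = f x * v x" for x
        by (cases "x \<in> S") (auto simp: q)
      then have "L2_inner S q v = (\<integral>x. f x * v x \<partial>lborel)"
        unfolding L2_inner_eq_lborel[OF borel(1) qb V_borel[OF v]] by (simp only:)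
      then show ?thesis
        using kernel[OF qL2[OF f(1) q]] proj v by simp
    qed
    have zero: "f x = 0" if "x \<in> \<Union>\<omega>" for x
    proof -
      from that obtain T where T: "T \<in> \<omega>" "x \<in> T" by blast
      show ?thesis by (rule orthogonal_imp_zero_on_elements[OF star fin disj elem f(1) orth T])
    qed
    \<comment> \<open>Points of \<open>S\<close> on the interfaces between elements are reached by
      continuity of the single polynomial \<open>f\<close>.\<close>
    have closure: "(\<Union>T\<in>\<omega>. closure T) \<subseteq> closure (\<Union>\<omega>)"
      by (intro UN_least closure_mono) blast
    have "f x = 0" if "x \<in> S" for x
    proof (rule continuous_constant_on_closure[where S = "\<Union>\<omega>" and f = f])
      show "continuous_on (closure (\<Union>\<omega>)) f" by (rule polynomial_deg_le_continuous_on[OF f(1)])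
      show "x \<in> closure (\<Union>\<omega>)"
        using that interior_subset unfolding S_def patch_domain_def \<omega>_def[symmetric]
        by (intro subsetD[OF closure]) blast
    qed (rule zero)
    then show "q \<in> {\<lambda>x. 0}" by (auto simp: q indicator_def)
  next
    fix q :: "real^'d \<Rightarrow> real" assume "q \<in> {\<lambda>x. 0}"
    then have q: "q = (\<lambda>x. 0)" by simp
    have "q \<in> L2_functions S" by (rule VL2) (simp add: q zeroV)
    from kernel[OF this] have "patch_projection \<T> z p q = (\<lambda>x. 0)"
      by (simp add: q L2_inner_def)
    moreover have "q \<in> polys_on (p + 1) (patch_domain \<T> z)"
      unfolding q polys_on_def using polynomial_deg_le_zero by blast
    ultimately show "q \<in> {q \<in> polys_on (p + 1) (patch_domain \<T> z). patch_projection \<T> z p q = (\<lambda>x. 0)}"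
      by simp
  qed
qed

end
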